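(* For every $q\in(0,1)$ there is a constant $c>0$ such that for all sufficiently large $n$, with $T:=\lceil c\,\log^{9/4} n/\sqrt{\log\log n}\,\rceil$, the probability of reconstructing random $n$-bit strings from $T$ traces of the deletion channel with deletion probability $q$ is at most $\exp(-n^{0.15})$; that is, for every function $G:\mathcal S^T\to\{0,1\}^n$, $$\sum_{\mathbf x\in\{0,1\}^n}2^{-n}\,\mathbf P_{\mathbf x}[G(\mathfrak X)=\mathbf x]\le \exp(-n^{0.15}).$$
   Context: $\log$ is the natural logarithm. The deletion channel with deletion probability $q$ takes an input string $\mathbf x\in\{0,1\}^n$, deletes each bit independently with probability $q$, and outputs the concatenation, in order, of the retained bits; the random output is called a trace. $\mathcal S=\bigcup_{k\ge0}\{0,1\}^k$. $\mathbf P_{\mathbf x}$ denotes probability when $\mathfrak X\in\mathcal S^T$ consists of $T$ independent traces of $\mathbf x$. A random $n$-bit string is one chosen uniformly from $\{0,1\}^n$. *)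

theory Defs
  imports "HOL-Probability.Probability"
begin

text \<open>Bits are Booleans; \<open>mask i\<close> holds iff position \<open>i\<close> (counted from 0) is retained.\<close>

definition trace_pmf :: "real \<Rightarrow> bool list \<Rightarrow> bool list pmf" where
  "trace_pmf q x =
     map_pmf (\<lambda>mask. nths x {i. mask i})
       (Pi_pmf {..<length x} False (\<lambda>_. bernoulli_pmf (1 - q)))"

text \<open>An element of \<open>\<S>\<^sup>T\<close> is a list of length \<open>T\<close> of finite bit strings.\<close>

definition traces_pmf :: "real \<Rightarrow> nat \<Rightarrow> bool list \<Rightarrow> bool list list pmf" where
  "traces_pmf q T x = replicate_pmf T (trace_pmf q x)"

definition reconstruction_prob ::
    "real \<Rightarrow> nat \<Rightarrow> nat \<Rightarrow> (bool list list \<Rightarrow> bool list) \<Rightarrow> real" where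
  "reconstruction_prob q n T G =
     (\<Sum>x | length x = n. (1 / 2 ^ n) * measure_pmf.prob (traces_pmf q T x) {ts. G ts = x})"

end

theory Submission
  imports Defs "HOL-Real_Asymp.Real_Asymp"
begin

text \<open>
  Split the random string into blocks of length \<open>m\<close> of order \<open>log n\<close>. Revealing the traces of the blocks
  separately makes the blocks independent, and in each block the two strings
  \<open>x = (01)\<^sup>k 10 (01)\<^sup>k\<^sup>+\<^sup>1\<close> and \<open>y = (01)\<^sup>k\<^sup>+\<^sup>1 10 (01)\<^sup>k\<close> are confused with a probability governed by the
  \<open>T\<close>-th power of their Bhattacharyya coefficient. So it suffices that the squared Hellinger distance of
  their traces is \<open>o(k\<^sup>-\<^sup>5\<^sup>/\<^sup>4)\<close>; it turns out to be \<open>O(k\<^sup>-\<^sup>1\<^sup>.\<^sup>3\<^sup>5)\<close>.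

  Write \<open>A k\<close> for the law of a trace of \<open>(01)\<^sup>k\<close>. Both trace laws are at least \<open>q\<^sup>2 A (2k+1)\<close>, and their
  difference at \<open>z\<close> is the sum over positions \<open>j\<close> of
  \<open>(1-q)\<^sup>2 (z\<^sub>j - z\<^sub>j\<^sub>+\<^sub>1) (A k a * A (k+1) c - A (k+1) a * A k c)\<close>, where \<open>a\<close> and \<open>c\<close> are the parts of \<open>z\<close> before
  and after these two bits. For typical \<open>a\<close> the ratio \<open>A (k+1) a / A k a\<close> is \<open>1 + O(\<epsilon>)\<close> with \<open>\<epsilon>\<close> slightly
  larger than \<open>k\<^sup>-\<^sup>1\<^sup>/\<^sup>2\<close>. Exchanging two neighbouring bits of \<open>z\<close> negates the term at that position, while
  the terms at distance at least \<open>3\<close>, which are \<open>O(\<epsilon>)\<close> times the share of the position in \<open>A (2k+1)\<close>,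
  change only by \<open>O(\<epsilon>\<^sup>2)\<close> times that share. So distant terms nearly decorrelate, and as each share is
  \<open>O(\<epsilon>)\<close>, the second moment of the sum with respect to \<open>A (2k+1)\<close> is \<open>O(\<epsilon>\<^sup>3)\<close>.
\<close>

section \<open>The law of a trace\<close>

text \<open>Recursion on whether the first input bit is deleted or retained.
  \<open>pmf_trace\<close> identifies the result with the law of \<open>trace_pmf\<close>, so that
  probabilities of traces can be computed by induction on strings.\<close>

fun trace_prob :: "real \<Rightarrow> bool list \<Rightarrow> bool list \<Rightarrow> real" where
  "trace_prob q [] z = (if z = [] then 1 else 0)"
| "trace_prob q (b # x) z = q * trace_prob q x z +
     (case z of [] \<Rightarrow> 0 | c # z' \<Rightarrow> if c = b then (1 - q) * trace_prob q x z' else 0)"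

text \<open>The product over all positions splits into the factor at 0 and the remaining factors,
  which are the masks of \<open>x\<close> shifted by one.\<close>

lemma trace_pmf_Cons:
  assumes "0 \<le> q" "q \<le> 1"
  shows "trace_pmf q (b # x) =
    bernoulli_pmf (1 - q) \<bind> (\<lambda>m. map_pmf (\<lambda>t. if m then b # t else t) (trace_pmf q x))"
proof -
  let ?B = "bernoulli_pmf (1 - q)"
  have set_eq: "{..<length (b # x)} = insert 0 (Suc ` {..<length x})"
    by (auto simp: lessThan_Suc_eq_insert_0)
  have shift: "Pi_pmf (Suc ` {..<length x}) False (\<lambda>_. ?B) =
      map_pmf (\<lambda>g i. if i = 0 then False else g (i - 1)) (Pi_pmf {..<length x} False (\<lambda>_. ?B))"
  proof -
    have "Pi_pmf {..<length x} False (\<lambda>_. ?B) =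
        map_pmf (\<lambda>f. f \<circ> Suc) (Pi_pmf (Suc ` {..<length x}) False (\<lambda>_. ?B))"
      by (rule Pi_pmf_bij_betw) (auto simp: bij_betw_def)
    hence "map_pmf (\<lambda>g i. if i = 0 then False else g (i - 1)) (Pi_pmf {..<length x} False (\<lambda>_. ?B))
       = map_pmf (\<lambda>f i. if i = 0 then False else f (Suc (i - 1))) (Pi_pmf (Suc ` {..<length x}) False (\<lambda>_. ?B))"
      by (simp add: pmf.map_comp o_def)
    also have "\<dots> = map_pmf (\<lambda>f. f) (Pi_pmf (Suc ` {..<length x}) False (\<lambda>_. ?B))"
    proof (rule map_pmf_cong[OF refl])
      fix f assume "f \<in> set_pmf (Pi_pmf (Suc ` {..<length x}) False (\<lambda>_. ?B))"
      \<comment> \<open>Position 0 lies outside the index set, so the mask takes its default value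
        \<open>False\<close> there.\<close>
      hence "f 0 = False" by (subst (asm) set_Pi_pmf) (auto simp: PiE_dflt_def)
      thus "(\<lambda>i. if i = 0 then False else f (Suc (i - 1))) = f" 
      proof (intro ext)
        fix i show "(if i = 0 then False else f (Suc (i - 1))) = f i"
          using \<open>f 0 = False\<close> by (cases i) auto
      qed
    qed
    finally show ?thesis by simp
  qed
  have "trace_pmf q (b # x) = ?B \<bind> (\<lambda>m. Pi_pmf (Suc ` {..<length x}) False (\<lambda>_. ?B) \<bind>
      (\<lambda>f. return_pmf (nths (b # x) {i. (f(0 := m)) i})))"
    unfolding trace_pmf_def set_eq
    by (subst Pi_pmf_insert)
       (auto simp: map_pmf_def pair_pmf_def bind_assoc_pmf bind_return_pmf)
  also have "\<dots> = ?B \<bind> (\<lambda>m. Pi_pmf {..<length x} False (\<lambda>_. ?B) \<bind>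
      (\<lambda>g. return_pmf (if m then b # nths x {i. g i} else nths x {i. g i})))"
    by (simp add: shift map_pmf_def bind_assoc_pmf bind_return_pmf nths_Cons)
       (intro bind_pmf_cong refl, auto)
  finally show ?thesis
    by (simp add: trace_pmf_def map_pmf_def bind_assoc_pmf bind_return_pmf)
qed

lemma trace_pmf_append:
  assumes "0 \<le> q" "q \<le> 1"
  shows "trace_pmf q (x @ y) = map_pmf (\<lambda>(s, t). s @ t) (pair_pmf (trace_pmf q x) (trace_pmf q y))"
proof (induction x)
  case Nil
  have "trace_pmf q [] = return_pmf []" by (simp add: trace_pmf_def)
  thus ?case by (simp add: map_pmf_def pair_pmf_def bind_assoc_pmf bind_return_pmf bind_return_pmf')
next
  case (Cons b x)
  show ?case
    by (simp add: trace_pmf_Cons[OF assms] Cons.IH map_pmf_def pair_pmf_def bind_assoc_pmf bind_return_pmf)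
       (auto intro!: bind_pmf_cong)
qed

lemma pmf_trace:
  assumes "0 \<le> q" "q \<le> 1"
  shows "pmf (trace_pmf q x) z = trace_prob q x z"
proof (induction x arbitrary: z)
  case Nil
  show ?case by (simp add: trace_pmf_def)
next
  case (Cons b x)
  have inj: "inj ((#) b)" by simp
  have 1: "pmf (map_pmf ((#) b) (trace_pmf q x)) z =
      (case z of [] \<Rightarrow> 0 | c # z' \<Rightarrow> if c = b then trace_prob q x z' else 0)"
  proof (cases "z \<in> range ((#) b)")
    case True
    then obtain z' where "z = b # z'" by auto
    thus ?thesis using pmf_map_inj'[OF inj, of "trace_pmf q x" z'] Cons.IH by simp
  next
    case False
    hence "pmf (map_pmf ((#) b) (trace_pmf q x)) z = 0"
      by (auto simp: pmf_eq_0_set_pmf)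
    thus ?thesis using False by (auto split: list.splits)
  qed
  show ?case using assms
    by (simp add: trace_pmf_Cons pmf_bind Cons.IH 1 map_pmf_ident split: list.splits)
qed

abbreviation lists_upto :: "nat \<Rightarrow> bool list set" where
  "lists_upto L \<equiv> {z. length z \<le> L}"

lemma finite_lists_upto [simp]: "finite (lists_upto L)"
  using finite_lists_length_le[of "UNIV :: bool set" L] by simp

lemma trace_prob_eq_0: "length x < length z \<Longrightarrow> trace_prob q x z = 0"
  by (induction q x z rule: trace_prob.induct) (auto split: list.splits)

text \<open>The sum runs over the hidden place \<open>j\<close> at which the trace of
  \<open>x\<close> ends and that of \<open>y\<close> begins.\<close>

lemma trace_prob_append:
  "trace_prob q (x @ y) z = (\<Sum>j\<le>length z. trace_prob q x (take j z) * trace_prob q y (drop j z))"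
proof (induction x arbitrary: z)
  case Nil
  have "(\<Sum>j\<le>length z. trace_prob q [] (take j z) * trace_prob q y (drop j z)) =
      (\<Sum>j\<in>{0}. trace_prob q [] (take j z) * trace_prob q y (drop j z))"
    by (rule sum.mono_neutral_right) auto
  thus ?case by simp
next
  case (Cons b x)
  show ?case
  proof (cases z)
    case Nil
    thus ?thesis by (simp add: Cons.IH)
  next
    case (Cons c z')
    show ?thesis unfolding Cons
      by (simp add: Cons.IH sum.atMost_Suc_shift sum_distrib_left sum_distrib_right algebra_simps sum.distrib
               del: sum.atMost_Suc)
  qed
qed

section \<open>Traces of alternating strings\<close>

text \<open>\<open>min_blocks s z\<close> is the least number of blocks \<open>01\<close> needed to embed \<open>z\<close> in
  \<open>010101\<dots>\<close> (\<open>s\<close> false) or in \<open>1010101\<dots>\<close> (\<open>s\<close> true, the leading \<open>1\<close> being free).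
  After embedding a word greedily, \<open>end_state\<close> tells which of the two situations the next bit meets.\<close>

fun min_blocks :: "bool \<Rightarrow> bool list \<Rightarrow> nat" where
  "min_blocks s [] = 0"
| "min_blocks s (b # z) = (if s \<and> b then 0 else 1) + min_blocks (\<not> b) z"

fun end_state :: "bool \<Rightarrow> bool list \<Rightarrow> bool" where
  "end_state s [] = s"
| "end_state s (b # z) = end_state (\<not> b) z"

lemma min_blocks_append: "min_blocks s (x @ y) = min_blocks s x + min_blocks (end_state s x) y"
  by (induction x arbitrary: s) auto

lemma end_state_append: "end_state s (x @ y) = end_state (end_state s x) y"
  by (induction x arbitrary: s) auto

lemma end_state_nonempty: "x \<noteq> [] \<Longrightarrow> end_state s x = end_state s' x"
  by (cases x) auto

lemma min_blocks_le_length: "min_blocks s z \<le> length z"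
proof (induction z arbitrary: s)
  case (Cons b z)
  show ?case using Cons[of "\<not> b"] by auto
qed auto

lemma min_blocks_True_le: "min_blocks True z \<le> min_blocks False z" "min_blocks False z \<le> Suc (min_blocks True z)"
  by (cases z; auto)+

lemma min_blocks_state: "min_blocks s z \<le> Suc (min_blocks s' z)"
  by (cases z; auto)

definition alt :: "nat \<Rightarrow> bool list" where
  "alt k = concat (replicate k [False, True])"

lemma alt_0 [simp]: "alt 0 = []" and alt_Suc: "alt (Suc k) = False # True # alt k"
  by (auto simp: alt_def)

lemma alt_add: "alt (j + k) = alt j @ alt k"
  by (simp add: alt_def replicate_add)

lemma length_alt [simp]: "length (alt k) = 2 * k"
  by (induction k) (auto simp: alt_Suc)

text \<open>A word of length \<open>n\<close> needing \<open>r\<close> blocks has this many embeddings into \<open>k\<close> blocks: the \<open>k - r\<close>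
  spare blocks are distributed over \<open>n + 1\<close> gaps.\<close>

definition embeddings :: "nat \<Rightarrow> nat \<Rightarrow> nat \<Rightarrow> real" where
  "embeddings k r n = (if r \<le> k then real ((k - r + n) choose n) else 0)"

text \<open>Pascal's rule. The value 0 for \<open>r > k\<close> makes it valid at the boundary
  \<open>r = Suc k\<close> as well.\<close>

lemma embeddings_pascal: "embeddings (Suc k) r (Suc n) = embeddings k r (Suc n) + embeddings (Suc k) r n"
proof -
  consider "r \<le> k" | "r = Suc k" | "r > Suc k" by linarith
  thus ?thesis
  proof cases
    case 1
    hence "Suc k - r + Suc n = Suc (Suc (k - r + n))" "Suc k - r + n = Suc (k - r + n)" by auto
    with 1 show ?thesis by (simp add: embeddings_def)
  qed (auto simp: embeddings_def)
qed

lemma embeddings_Suc_Suc [simp]: "embeddings (Suc k) (Suc r) n = embeddings k r n"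
  by (simp add: embeddings_def)

locale deletion =
  fixes q :: real
  assumes q0: "0 < q" and q1: "q < 1"
begin

lemma trace_prob_nonneg: "0 \<le> trace_prob q x z"
  using q0 q1 by (induction q x z rule: trace_prob.induct) (auto split: list.splits)

lemma set_trace_pmf: "set_pmf (trace_pmf q x) \<subseteq> lists_upto (length x)"
proof
  fix z assume "z \<in> set_pmf (trace_pmf q x)"
  hence "trace_prob q x z \<noteq> 0"
    using pmf_trace[of q x z] q0 q1 by (simp add: set_pmf_iff)
  thus "z \<in> lists_upto (length x)"
    using trace_prob_eq_0[of x z q] by (auto simp: not_le[symmetric])
qed

lemma sum_trace_prob:
  assumes "length x \<le> L"
  shows "(\<Sum>z\<in>lists_upto L. trace_prob q x z) = 1"
proof -
  have "set_pmf (trace_pmf q x) \<subseteq> lists_upto L"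
    using set_trace_pmf[of x] assms by auto
  hence "(\<Sum>z\<in>lists_upto L. pmf (trace_pmf q x) z) = 1"
    by (intro sum_pmf_eq_1) auto
  thus ?thesis using q0 q1 by (simp add: pmf_trace)
qed

definition \<theta> :: real where "\<theta> = (1 - q) / q"

lemma \<theta>_pos: "0 < \<theta>" using q0 q1 by (simp add: \<theta>_def)

lemma q_\<theta>: "q * \<theta> = 1 - q" using q0 by (simp add: \<theta>_def)

text \<open>The recursion removes one bit at a time, so the induction for \<open>alt\<close> passes
  through strings that begin with half a block. The free leading \<open>1\<close> is what the state
  \<open>True\<close> of \<open>min_blocks\<close> describes.\<close>

lemma trace_prob_True_alt_step:
  assumes IH: "\<And>z. trace_prob q (alt k) z = \<theta> ^ length z * q ^ (2 * k) * embeddings k (min_blocks False z) (length z)"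
  shows "trace_prob q (True # alt k) z = \<theta> ^ length z * q ^ (2 * k + 1) * embeddings k (min_blocks True z) (length z)"
proof (cases z)
  case Nil
  thus ?thesis by (simp add: IH)
next
  case (Cons c z')
  show ?thesis
  proof (cases c)
    case False
    thus ?thesis by (simp add: IH Cons)
  next
    case True
    have "embeddings k (min_blocks False z') (Suc (length z')) =
        embeddings k (Suc (min_blocks False z')) (Suc (length z')) + embeddings k (min_blocks False z') (length z')"
      using embeddings_pascal[of "k - 1" "min_blocks False z'" "length z'"]
      by (cases k) (auto simp: embeddings_def)
    thus ?thesis using True
      by (simp add: IH Cons q_\<theta>[symmetric] algebra_simps)
  qed
qed

text \<open>For words of length n the factor \<open>\<theta> ^ n * q ^ (2 * k)\<close> is (1-q)^n
  q^(2k-n), the probability that a given set of n positions is retained. The formula thus says that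
  \<open>embeddings\<close> counts the sets of positions that spell \<open>z\<close>.\<close>

lemma trace_prob_alt:
  "trace_prob q (alt k) z = \<theta> ^ length z * q ^ (2 * k) * embeddings k (min_blocks False z) (length z)"
proof (induction k arbitrary: z)
  case 0
  show ?case by (cases z) (auto simp: embeddings_def)
next
  case (Suc k)
  have T: "trace_prob q (True # alt k) z = \<theta> ^ length z * q ^ (2 * k + 1) * embeddings k (min_blocks True z) (length z)" for z
    by (rule trace_prob_True_alt_step[OF Suc.IH])
  show ?case
  proof (cases z)
    case Nil
    thus ?thesis by (simp add: alt_Suc Suc.IH embeddings_def)
  next
    case (Cons c z')
    show ?thesis
    proof (cases c)
      case True
      have "trace_prob q (alt (Suc k)) z = q * trace_prob q (True # alt k) z"
        by (simp only: alt_Suc trace_prob.simps(2)[of q False]) (simp add: Cons True)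
      thus ?thesis by (simp add: T Cons True del: trace_prob.simps)
    next
      case False
      have "trace_prob q (alt (Suc k)) z = q * trace_prob q (True # alt k) z + (1 - q) * trace_prob q (True # alt k) z'"
        by (simp only: alt_Suc trace_prob.simps(2)[of q False]) (simp add: Cons False)
      also have "\<dots> = q * (\<theta> ^ length z * q ^ (2 * k + 1) * embeddings k (min_blocks True z) (length z))
           + q * \<theta> * (\<theta> ^ length z' * q ^ (2 * k + 1) * embeddings k (min_blocks True z') (length z'))"
        by (simp only: T q_\<theta>)
      also have "\<dots> = \<theta> ^ length z * q ^ (2 * Suc k) *
          (embeddings k (Suc (min_blocks True z')) (Suc (length z')) + embeddings k (min_blocks True z') (length z'))"
        by (simp add: Cons False algebra_simps)
      also have "embeddings k (Suc (min_blocks True z')) (Suc (length z')) + embeddings k (min_blocks True z') (length z') =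
          embeddings (Suc k) (Suc (min_blocks True z')) (Suc (length z'))"
        using embeddings_pascal[of k "Suc (min_blocks True z')" "length z'"] by simp
      finally show ?thesis by (simp add: Cons False)
    qed
  qed
qed

end

section \<open>Exchanging two neighbouring bits of a trace\<close>

definition sgnbit :: "bool list \<Rightarrow> nat \<Rightarrow> real" where
  "sgnbit z j = of_bool (z ! j) - of_bool (z ! Suc j)"

lemma abs_sgnbit: "\<bar>sgnbit z j\<bar> \<le> 1"
  by (auto simp: sgnbit_def)

text \<open>Out of range it is the identity, which makes it an involution of
  \<open>lists_upto L\<close> for every \<open>j\<close>.\<close>

definition swap_adj :: "nat \<Rightarrow> 'a list \<Rightarrow> 'a list" where
  "swap_adj j z = (if j + 2 \<le> length z then take j z @ [z ! Suc j, z ! j] @ drop (j + 2) z else z)"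

lemma split_at_pair:
  assumes "j + 2 \<le> length z"
  obtains a x y c where "z = a @ [x, y] @ c" "length a = j"
proof
  show "z = take j z @ [z ! j, z ! Suc j] @ drop (j + 2) z"
    using assms by (simp add: Cons_nth_drop_Suc)
  show "length (take j z) = j" using assms by simp
qed

lemma swap_adj_split: "length a = j \<Longrightarrow> swap_adj j (a @ [x, y] @ c) = a @ [y, x] @ c"
  by (auto simp: swap_adj_def nth_append)

lemma length_swap_adj [simp]: "length (swap_adj j z) = length z"
  by (auto simp: swap_adj_def)

lemma swap_adj_swap_adj [simp]: "swap_adj j (swap_adj j z) = z"
proof (cases "j + 2 \<le> length z")
  case True
  then obtain a x y c where "z = a @ [x, y] @ c" "length a = j" by (rule split_at_pair)
  thus ?thesis using swap_adj_split[of a j x y c] swap_adj_split[of a j y x c] by simp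
qed (simp add: swap_adj_def)

lemma take_swap_adj [simp]: "take j (swap_adj j z) = take j z"
  and drop_swap_adj [simp]: "drop (j + 2) (swap_adj j z) = drop (j + 2) z"
  by (auto simp: swap_adj_def)

lemma sgnbit_swap_adj: "j + 2 \<le> length z \<Longrightarrow> sgnbit (swap_adj j z) j = - sgnbit z j"
  by (auto simp: sgnbit_def swap_adj_def nth_append)

lemma bij_swap_adj: "bij_betw (swap_adj j) (lists_upto L) (lists_upto L)"
  by (rule bij_betw_byWitness[where f' = "swap_adj j"]) auto

lemma min_blocks_swap_pair: "\<bar>int (min_blocks s (x # y # c)) - int (min_blocks s (y # x # c))\<bar> \<le> 1"
  using min_blocks_True_le[of c] by (cases x; cases y; cases s) auto

text \<open>At least one bit \<open>e\<close> of the prefix follows the exchanged pair. After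
  \<open>e\<close> the state depends on \<open>e\<close> alone, so the exchange has a local effect
  \<open>d\<close> on the number of blocks, the same for the prefix and for the whole word.\<close>

lemma swap_adj_before:
  assumes "i + 3 \<le> j" "j \<le> length z"
  shows "drop j (swap_adj i z) = drop j z"
    and "\<exists>d. \<bar>d\<bar> \<le> 1 \<and> int (min_blocks s (swap_adj i z)) = int (min_blocks s z) + d \<and>
          int (min_blocks s (take j (swap_adj i z))) = int (min_blocks s (take j z)) + d"
proof -
  have "i + 2 \<le> length (take j z)" using assms by simp
  then obtain a x y c1 where z1: "take j z = a @ [x, y] @ c1" "length a = i" by (rule split_at_pair)
  have "length (take j z) = j" using assms by simp
  hence j: "j = i + 2 + length c1" using z1 by simp
  have c1: "c1 \<noteq> []" using j assms by auto
  have z: "z = a @ [x, y] @ (c1 @ drop j z)"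
    using append_take_drop_id[of j z] z1 by (metis append.assoc)
  have sz: "swap_adj i z = a @ [y, x] @ (c1 @ drop j z)"
    using swap_adj_split[OF z1(2), of x y "c1 @ drop j z"] z by simp
  have tk: "take j (swap_adj i z) = a @ [y, x] @ c1"
    unfolding sz using j z1 by simp
  show "drop j (swap_adj i z) = drop j z"
    unfolding sz using j z1 by simp
  obtain e c2 where c1e: "c1 = e # c2" using c1 by (cases c1) auto
  define d where "d = int (min_blocks (end_state s a) [y, x, e]) - int (min_blocks (end_state s a) [x, y, e])"
  show "\<exists>d. \<bar>d\<bar> \<le> 1 \<and> int (min_blocks s (swap_adj i z)) = int (min_blocks s z) + d \<and>
          int (min_blocks s (take j (swap_adj i z))) = int (min_blocks s (take j z)) + d"
  proof (intro exI[of _ d] conjI)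
    show "\<bar>d\<bar> \<le> 1" unfolding d_def by (rule min_blocks_swap_pair)
    have *: "int (min_blocks s (a @ [y, x] @ (e # c))) = int (min_blocks s (a @ [x, y] @ (e # c))) + d" for c
      by (simp add: min_blocks_append d_def)
    show "int (min_blocks s (swap_adj i z)) = int (min_blocks s z) + d"
      unfolding sz using * z by (simp add: c1e)
    show "int (min_blocks s (take j (swap_adj i z))) = int (min_blocks s (take j z)) + d"
      unfolding tk z1(1) using * by (simp add: c1e)
  qed
qed

text \<open>At least one bit separates position \<open>j\<close> from the exchanged pair. It erases
  the initial state, so reading from the start and reading from \<open>j\<close> reach the pair in
  the same state and see the same change \<open>d\<close>.\<close>

lemma swap_adj_after:
  assumes "j + 1 \<le> i" "i + 2 \<le> length z"
  shows "take j (swap_adj i z) = take j z"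
    and "\<exists>d. \<bar>d\<bar> \<le> 1 \<and> int (min_blocks s (swap_adj i z)) = int (min_blocks s z) + d \<and>
          int (min_blocks s' (drop j (swap_adj i z))) = int (min_blocks s' (drop j z)) + d"
proof -
  have jz: "j \<le> length z" using assms by simp
  have "(i - j) + 2 \<le> length (drop j z)" using assms by simp
  then obtain b x y c where z1: "drop j z = b @ [x, y] @ c" "length b = i - j" by (rule split_at_pair)
  have b: "b \<noteq> []" using z1 assms by auto
  have z: "z = (take j z @ b) @ [x, y] @ c"
    using append_take_drop_id[of j z] z1 by (metis append.assoc)
  have sz: "swap_adj i z = (take j z @ b) @ [y, x] @ c"
    using swap_adj_split[of "take j z @ b" i x y c] z z1 assms jz by simp
  have dr: "drop j (swap_adj i z) = b @ [y, x] @ c"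
    unfolding sz using jz by simp
  show "take j (swap_adj i z) = take j z"
    unfolding sz using jz by simp
  have st: "end_state s (take j z @ b) = end_state s' b"
    using end_state_nonempty[OF b] by (simp add: end_state_append)
  define d where "d = int (min_blocks (end_state s' b) (y # x # c)) - int (min_blocks (end_state s' b) (x # y # c))"
  show "\<exists>d. \<bar>d\<bar> \<le> 1 \<and> int (min_blocks s (swap_adj i z)) = int (min_blocks s z) + d \<and>
          int (min_blocks s' (drop j (swap_adj i z))) = int (min_blocks s' (drop j z)) + d"
  proof (intro exI[of _ d] conjI)
    show "\<bar>d\<bar> \<le> 1" unfolding d_def by (rule min_blocks_swap_pair)
    have "int (min_blocks s ((take j z @ b) @ [y, x] @ c)) = int (min_blocks s ((take j z @ b) @ [x, y] @ c)) + d"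
      by (subst (1 2) min_blocks_append) (simp add: st d_def)
    thus "int (min_blocks s (swap_adj i z)) = int (min_blocks s z) + d"
      unfolding sz using z by metis
    have "int (min_blocks s' (b @ [y, x] @ c)) = int (min_blocks s' (b @ [x, y] @ c)) + d"
      by (subst (1 2) min_blocks_append) (simp add: d_def)
    thus "int (min_blocks s' (drop j (swap_adj i z))) = int (min_blocks s' (drop j z)) + d"
      unfolding dr z1(1) .
  qed
qed

lemma embeddings_Suc: "r \<le> k \<Longrightarrow> embeddings (Suc k) r n * (real k - real r + 1) = embeddings k r n * (real k - real r + 1 + real n)"
proof -
  assume r: "r \<le> k"
  define u where "u = k - r"
  have k: "k = u + r" using r by (simp add: u_def)
  have "Suc (u + n) * ((u + n) choose u) = (Suc (u + n) choose Suc u) * Suc u"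
    by (rule Suc_times_binomial_eq)
  moreover have "((u + n) choose u) = ((u + n) choose n)" "(Suc (u + n) choose Suc u) = (Suc (u + n) choose n)"
    using binomial_symmetric[of u "u + n"] binomial_symmetric[of "Suc u" "Suc (u + n)"] by auto
  ultimately have "Suc (u + n) * ((u + n) choose n) = (Suc (u + n) choose n) * Suc u" by simp
  hence "real (Suc (u + n)) * real ((u + n) choose n) = real (Suc (u + n) choose n) * real (Suc u)"
    by (metis of_nat_mult)
  thus ?thesis by (simp add: embeddings_def k Suc_diff_le algebra_simps)
qed

section \<open>Trace laws of the two defective strings\<close>

context deletion
begin

abbreviation A :: "nat \<Rightarrow> bool list \<Rightarrow> real" where "A k \<equiv> trace_prob q (alt k)"

lemma sum_trace_prob_le: "(\<Sum>z\<in>lists_upto L. trace_prob q x z) \<le> 1"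
proof -
  have "(\<Sum>z\<in>lists_upto L. trace_prob q x z) \<le> (\<Sum>z\<in>lists_upto (max L (length x)). trace_prob q x z)"
    by (intro sum_mono2) (auto simp: trace_prob_nonneg)
  also have "\<dots> = 1" by (rule sum_trace_prob) simp
  finally show ?thesis .
qed

text \<open>The left side is the contribution of the event that the inserted bit is deleted.\<close>

lemma trace_prob_delete: "q * trace_prob q (x @ y) z \<le> trace_prob q (x @ b # y) z"
proof -
  have "q * trace_prob q (x @ y) z = (\<Sum>j\<le>length z. trace_prob q x (take j z) * (q * trace_prob q y (drop j z)))"
    by (simp add: trace_prob_append sum_distrib_left mult_ac)
  also have "\<dots> \<le> (\<Sum>j\<le>length z. trace_prob q x (take j z) * trace_prob q (b # y) (drop j z))"
    using q0 q1 by (intro sum_mono mult_left_mono) (auto simp: trace_prob_nonneg split: list.splits)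
  finally show ?thesis by (simp add: trace_prob_append)
qed

text \<open>If at most one bit of the pair is retained, both orders contribute equally. There
  remains the event that both are retained, of probability (1-q)^2, and \<open>sgnbit\<close> is 1
  if they spell \<open>10\<close> and -1 if they spell \<open>01\<close>.\<close>

lemma trace_prob_exchange_pair:
  "trace_prob q (x @ [True, False] @ y) z - trace_prob q (x @ [False, True] @ y) z =
   (\<Sum>j\<le>length z. if j + 2 \<le> length z
      then (1 - q)\<^sup>2 * sgnbit z j * (trace_prob q x (take j z) * trace_prob q y (drop (j + 2) z)) else 0)"
proof -
  have base: "trace_prob q ([True, False] @ y) d - trace_prob q ([False, True] @ y) d =
      (if 2 \<le> length d then (1 - q)\<^sup>2 * sgnbit d 0 * trace_prob q y (drop 2 d) else 0)" for d
    by (cases d; cases "tl d"; cases "hd d"; cases "hd (tl d)")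
       (auto simp: sgnbit_def power2_eq_square algebra_simps)
  have "trace_prob q (x @ [True, False] @ y) z - trace_prob q (x @ [False, True] @ y) z =
      (\<Sum>j\<le>length z. trace_prob q x (take j z) * (trace_prob q ([True, False] @ y) (drop j z) - trace_prob q ([False, True] @ y) (drop j z)))"
    by (simp only: trace_prob_append[of q x] sum_subtractf[symmetric] right_diff_distrib)
  also have "\<dots> = (\<Sum>j\<le>length z. if j + 2 \<le> length z
      then (1 - q)\<^sup>2 * sgnbit z j * (trace_prob q x (take j z) * trace_prob q y (drop (j + 2) z)) else 0)"
    unfolding base
    by (rule sum.cong) (auto simp: sgnbit_def nth_drop add.commute)
  finally show ?thesis .
qed

definition defect_left :: "nat \<Rightarrow> bool list" where "defect_left k = alt k @ [True, False] @ alt (Suc k)"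
definition defect_right :: "nat \<Rightarrow> bool list" where "defect_right k = alt (Suc k) @ [True, False] @ alt k"

definition Y :: "nat \<Rightarrow> nat \<Rightarrow> bool list \<Rightarrow> real" where
  "Y k j z = (if j + 2 \<le> length z then (1 - q)\<^sup>2 * sgnbit z j *
     (A k (take j z) * A (Suc k) (drop (j + 2) z) - A (Suc k) (take j z) * A k (drop (j + 2) z)) else 0)"

lemma alt_pair: "alt k @ [False, True] @ alt (Suc k) = alt (2 * k + 2)"
  "alt (Suc k) @ [False, True] @ alt k = alt (2 * k + 2)"
proof -
  have "[False, True] = alt 1" by (simp add: alt_def)
  thus "alt k @ [False, True] @ alt (Suc k) = alt (2 * k + 2)" "alt (Suc k) @ [False, True] @ alt k = alt (2 * k + 2)"
    by (simp_all only: alt_add[symmetric]) (auto intro!: arg_cong[of _ _ alt])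
qed

text \<open>Each string arises from \<open>alt (2 * k + 2)\<close> by exchanging the bits of one
  block. Comparing both with this common string reduces the difference to two pair
  exchanges.\<close>

lemma trace_prob_diff_eq_sum_Y: "trace_prob q (defect_left k) z - trace_prob q (defect_right k) z = (\<Sum>j\<le>length z. Y k j z)"
proof -
  have "trace_prob q (defect_left k) z - trace_prob q (defect_right k) z = (trace_prob q (defect_left k) z - A (2 * k + 2) z) - (trace_prob q (defect_right k) z - A (2 * k + 2) z)"
    by simp
  also have "\<dots> = (\<Sum>j\<le>length z. Y k j z)"
    unfolding defect_left_def defect_right_def alt_pair(1)[symmetric, of k] trace_prob_exchange_pair
    unfolding alt_pair(1)[of k] alt_pair(2)[symmetric, of k] trace_prob_exchange_pair sum_subtractf[symmetric]
    by (rule sum.cong) (auto simp: Y_def algebra_simps)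
  finally show ?thesis .
qed

text \<open>Deleting the two bits of the defect leaves an alternating string.\<close>

lemma trace_prob_ge_alt: "q\<^sup>2 * A (2 * k + 1) z \<le> trace_prob q (defect_left k) z" "q\<^sup>2 * A (2 * k + 1) z \<le> trace_prob q (defect_right k) z"
proof -
  have *: "q\<^sup>2 * trace_prob q (x @ y) z \<le> trace_prob q (x @ [True, False] @ y) z" for x y
  proof -
    have "q\<^sup>2 * trace_prob q (x @ y) z \<le> q * trace_prob q (x @ False # y) z"
      using mult_left_mono[OF trace_prob_delete[of x y z False], of q] q0 by (simp add: power2_eq_square mult.assoc)
    also have "\<dots> \<le> trace_prob q (x @ True # False # y) z" by (rule trace_prob_delete)
    finally show ?thesis by simp
  qed
  have "alt (2 * k + 1) = alt k @ alt (Suc k)" "alt (2 * k + 1) = alt (Suc k) @ alt k"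
    by (simp_all only: alt_add[symmetric]) (auto intro!: arg_cong[of _ _ alt])
  thus "q\<^sup>2 * A (2 * k + 1) z \<le> trace_prob q (defect_left k) z" "q\<^sup>2 * A (2 * k + 1) z \<le> trace_prob q (defect_right k) z"
    using * unfolding defect_left_def defect_right_def by metis+
qed

lemma Y_swap_adj: "Y k j (swap_adj j z) = - Y k j z"
  by (simp add: Y_def sgnbit_swap_adj del: drop_swap_adj)
     (use drop_swap_adj[of j z] in \<open>simp add: algebra_simps\<close>)

text \<open>The likelihood ratio of one more block; it is close to \<open>1\<close> exactly when \<open>drift\<close> below is small
  compared to \<open>k\<close>.\<close>

definition \<rho> :: "nat \<Rightarrow> bool list \<Rightarrow> real" where
  "\<rho> k a = q\<^sup>2 * (real k - real (min_blocks False a) + 1 + real (length a)) / (real k - real (min_blocks False a) + 1)"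

definition drift :: "nat \<Rightarrow> bool list \<Rightarrow> real" where
  "drift k a = q\<^sup>2 * real (length a) - (1 - q\<^sup>2) * (real k - real (min_blocks False a))"

lemma \<rho>_drift:
  assumes "real (min_blocks False a) < real k + 1"
  shows "\<rho> k a = 1 + (drift k a - (1 - q\<^sup>2)) / (real k - real (min_blocks False a) + 1)"
  using assms by (simp add: \<rho>_def drift_def field_simps)

lemma A_eq_0: "k < min_blocks False a \<Longrightarrow> A k a = 0"
  by (simp add: trace_prob_alt embeddings_def)

lemma A_pos: "min_blocks False a \<le> k \<Longrightarrow> 0 < A k a"
  using q0 \<theta>_pos by (simp add: trace_prob_alt embeddings_def)

lemma A_Suc: "min_blocks False a \<le> k \<Longrightarrow> A (Suc k) a = A k a * \<rho> k a"
proof -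
  assume r: "min_blocks False a \<le> k"
  hence pos: "0 < real k - real (min_blocks False a) + 1" by simp
  have "A (Suc k) a = \<theta> ^ length a * q ^ (2 * Suc k) * embeddings (Suc k) (min_blocks False a) (length a)"
    by (rule trace_prob_alt)
  also have "embeddings (Suc k) (min_blocks False a) (length a) =
      embeddings k (min_blocks False a) (length a) * (real k - real (min_blocks False a) + 1 + real (length a)) / (real k - real (min_blocks False a) + 1)"
    using embeddings_Suc[OF r, of "length a"] pos by (simp add: field_simps)
  finally show ?thesis by (simp add: trace_prob_alt \<rho>_def power2_eq_square)
qed

text \<open>Needing one block less has the same effect on \<open>embeddings\<close> as having one
  block more, so the likelihood ratio \<open>\<rho>\<close> also governs changes of
  \<open>min_blocks\<close>.\<close>

lemma A_rank_shift:
  assumes "length a' = length a" "min_blocks False a = Suc (min_blocks False a')" "min_blocks False a \<le> k"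
  shows "A k a' = A k a * \<rho> k a / q\<^sup>2"
proof -
  have "A k a' = \<theta> ^ length a * q ^ (2 * k) * embeddings (Suc k) (min_blocks False a) (length a)"
    using assms by (simp add: trace_prob_alt)
  also have "\<dots> = A (Suc k) a / q\<^sup>2"
    using q0 by (simp add: trace_prob_alt power2_eq_square)
  also have "A (Suc k) a = A k a * \<rho> k a" by (rule A_Suc) fact
  finally show ?thesis .
qed

lemma q2: "0 < q\<^sup>2" "q\<^sup>2 < 1"
  using q0 q1 by (auto simp: power_less_one_iff abs_square_less_1)

lemma drift_shift: "drift (k + j) a = drift k a - (1 - q\<^sup>2) * real j"
  by (simp add: drift_def algebra_simps)

section \<open>Typical words\<close>

text \<open>If the drift at \<open>k\<close> exceeds \<open>\<Lambda>\<close>, then each of the first \<open>J\<close> likelihood ratios on the way from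
  \<open>k\<close> to \<open>k \<plusminus> J\<close> gains a definite factor; as \<open>A (k \<plusminus> J)\<close> has total mass at most \<open>1\<close>, such words
  are rare. This replaces a large deviation estimate for the trace.\<close>

lemma A_tail:
  fixes J k :: nat
  assumes \<Lambda>: "0 < \<Lambda>" and J: "2 * real J \<le> \<Lambda>" "J \<le> k" and k: "0 < k"
  shows "(\<Sum>z\<in>lists_upto L. if \<Lambda> < \<bar>drift k z\<bar> then A k z else 0) \<le> 2 / (1 + \<Lambda> / (4 * real k)) ^ J"
proof -
  define g where "g = 1 + \<Lambda> / (4 * real k)"
  have g: "0 < g" using \<Lambda> by (simp add: g_def add_pos_nonneg)
  have up: "g ^ i * A k z \<le> A (k + i) z" if z: "\<Lambda> < drift k z" "min_blocks False z \<le> k" and i: "i \<le> J" for z i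
    using i
  proof (induction i)
    case (Suc i)
    let ?u = "real (k + i) - real (min_blocks False z) + 1"
    have u: "0 < ?u" "?u \<le> 2 * real k" using z Suc.prems J by auto
    have si: "real i + 1 \<le> real J" using Suc.prems by linarith
    have "(1 - q\<^sup>2) * (real i + 1) \<le> 1 * real J"
      by (rule mult_mono) (use q2 si in auto)
    \<comment> \<open>Each step lowers the drift by less than 1, so
      \<open>2 * real J \<le> \<Lambda>\<close> keeps at least half of it through all
      \<open>J\<close> steps.\<close>
    hence l: "drift (k + i) z - (1 - q\<^sup>2) \<ge> \<Lambda> / 2" using J z unfolding drift_shift by (simp add: algebra_simps)
    have "\<Lambda> / (4 * real k) = (\<Lambda> / 2) / (2 * real k)" by simp
    also have "\<dots> \<le> (drift (k + i) z - (1 - q\<^sup>2)) / ?u"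
      by (rule frac_le) (use \<Lambda> u l in auto)
    finally have "g \<le> \<rho> (k + i) z" using u unfolding g_def by (subst \<rho>_drift) (simp_all add: algebra_simps)
    hence "g * A (k + i) z \<le> A (Suc (k + i)) z"
      using z by (subst A_Suc) (auto simp: trace_prob_nonneg mult.commute intro!: mult_right_mono)
    moreover have "g * (g ^ i * A k z) \<le> g * A (k + i) z"
      using Suc g by (intro mult_left_mono) auto
    ultimately show ?case by (simp add: mult.assoc)
  qed simp
  have down: "g ^ i * A k z \<le> A (k - i) z" if z: "drift k z < - \<Lambda>" "min_blocks False z \<le> k" and i: "i \<le> J" for z i
    using i
  proof (induction i)
    case (Suc i)
    define m where "m = k - Suc i"
    have m: "k = m + Suc i" "k - i = Suc m" using Suc.prems J by (auto simp: m_def)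
    let ?u = "real m - real (min_blocks False z) + 1"
    have si: "real i + 1 \<le> real J" using Suc.prems by linarith
    \<comment> \<open>A large negative drift forces many spare blocks, which leaves room for
      removing \<open>J\<close> of them.\<close>
    have "\<Lambda> \<le> (1 - q\<^sup>2) * (real k - real (min_blocks False z))"
      using z q2 unfolding drift_def by (smt (verit) mult_nonneg_nonneg of_nat_0_le_iff)
    also have "\<dots> \<le> 1 * (real k - real (min_blocks False z))"
      by (rule mult_right_mono) (use q2 z in auto)
    finally have kr: "2 * real J \<le> real k - real (min_blocks False z)" using J by simp
    have u: "0 < ?u" "?u \<le> real k" using kr si m(1) by auto
    have rm: "min_blocks False z \<le> m" using kr si m(1) by linarith
    have "(1 - q\<^sup>2) * real i \<le> 1 * real J"
      by (rule mult_mono) (use q2 si in auto)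
    hence l: "drift m z - (1 - q\<^sup>2) \<le> - (\<Lambda> / 2)"
      using J z drift_shift[of m "Suc i" z] unfolding m(1)[symmetric] by (simp add: algebra_simps)
    have "\<Lambda> / 2 / real k \<le> (- (drift m z - (1 - q\<^sup>2))) / ?u"
      by (rule frac_le) (use \<Lambda> u l in auto)
    also have "\<dots> = - ((drift m z - (1 - q\<^sup>2)) / ?u)" by (rule minus_divide_left[symmetric])
    finally have rho: "\<rho> m z \<le> 1 - \<Lambda> / (2 * real k)"
      using u by (subst \<rho>_drift) simp_all
    have "g * \<rho> m z \<le> g * (1 - \<Lambda> / (2 * real k))"
      using rho g by (intro mult_left_mono) auto
    also have "\<dots> \<le> 1" using \<Lambda> k by (simp add: g_def field_simps)
    finally have "g * A (k - i) z \<le> A m z"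
      unfolding m(2) using rm
      by (subst A_Suc) (auto simp: trace_prob_nonneg mult.left_commute[of g] intro!: mult_left_le)
    moreover have "g * (g ^ i * A k z) \<le> g * A (k - i) z"
      using Suc g by (intro mult_left_mono) auto
    ultimately show ?case by (simp add: mult.assoc m_def)
  qed simp
  have "(\<Sum>z\<in>lists_upto L. if \<Lambda> < \<bar>drift k z\<bar> then A k z else 0)
      \<le> (\<Sum>z\<in>lists_upto L. (A (k + J) z + A (k - J) z) / g ^ J)"
  proof (rule sum_mono)
    fix z :: "bool list"
    show "(if \<Lambda> < \<bar>drift k z\<bar> then A k z else 0) \<le> (A (k + J) z + A (k - J) z) / g ^ J"
    proof (cases "\<Lambda> < \<bar>drift k z\<bar> \<and> min_blocks False z \<le> k")
      case True
      hence "g ^ J * A k z \<le> A (k + J) z + A (k - J) z"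
        using up[of z J] down[of z J] trace_prob_nonneg[of "alt (k + J)" z] trace_prob_nonneg[of "alt (k - J)" z]
        by linarith
      thus ?thesis using True g by (simp add: field_simps)
    next
      case False
      hence "(if \<Lambda> < \<bar>drift k z\<bar> then A k z else 0) = 0" using A_eq_0[of k z] by auto
      thus ?thesis using g by (simp add: trace_prob_nonneg)
    qed
  qed
  also have "\<dots> = ((\<Sum>z\<in>lists_upto L. A (k + J) z) + (\<Sum>z\<in>lists_upto L. A (k - J) z)) / g ^ J"
    by (simp add: sum.distrib sum_divide_distrib[symmetric])
  also have "\<dots> \<le> 2 / g ^ J"
    using sum_trace_prob_le[of "alt (k + J)" L] sum_trace_prob_le[of "alt (k - J)" L] g
    by (intro divide_right_mono) auto
  finally show ?thesis by (simp add: g_def)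
qed

end

section \<open>Likelihood ratios inside the typical window\<close>

locale window = deletion +
  fixes k :: nat and \<Lambda> :: real
  assumes \<Lambda>_ge_1: "1 \<le> \<Lambda>" and k_le_\<Lambda>: "real k \<le> \<Lambda>\<^sup>2" and \<Lambda>_small: "1000 * \<Lambda> \<le> q\<^sup>2 * real k"
begin

text \<open>The order of the deviation of a likelihood ratio from 1 when the drift is of order
  \<open>\<Lambda>\<close>. The assumption \<open>k_le_\<Lambda>\<close> makes 1/k of second order
  and 1/\<open>\<Lambda>\<close> of first order in \<open>\<epsilon>\<close>.\<close>

definition \<epsilon> :: real where "\<epsilon> = \<Lambda> / (q\<^sup>2 * real k)"

lemma k_pos: "0 < real k"
  using \<Lambda>_small \<Lambda>_ge_1 q2 by (smt (verit) mult_nonneg_nonpos of_nat_0_le_iff zero_less_mult_iff)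

lemma \<epsilon>: "0 < \<epsilon>" "\<epsilon> \<le> 1 / 1000"
  using \<Lambda>_ge_1 \<Lambda>_small k_pos q2 by (auto simp: \<epsilon>_def field_simps)

text \<open>A word of length at most k/2 needs at most k/2 blocks. For a longer word q^2 times the
  length is at least q^2 k/2, and as the drift is small, the spare blocks have to balance
  it.\<close>

lemma window_bounds:
  assumes "\<bar>drift k a\<bar> \<le> 5 * \<Lambda>"
  shows "q\<^sup>2 * real k / 4 \<le> real k - real (min_blocks False a)"
    and "q\<^sup>2 * real (length a) \<le> real k"
    and "min_blocks False a \<le> k"
proof -
  have r: "real (min_blocks False a) \<le> real (length a)" using min_blocks_le_length[of False a] by simp
  have bk: "q\<^sup>2 * real k \<le> real k" using q2 k_pos by simp
  show *: "q\<^sup>2 * real k / 4 \<le> real k - real (min_blocks False a)"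
  proof (cases "real (length a) \<le> real k / 2")
    case True
    thus ?thesis using r bk by linarith
  next
    case False
    have "q\<^sup>2 * (real k / 2) \<le> q\<^sup>2 * real (length a)"
      using False q2 by (intro mult_left_mono) auto
    hence l: "q\<^sup>2 * real k / 4 \<le> (1 - q\<^sup>2) * (real k - real (min_blocks False a))"
      using assms \<Lambda>_small \<Lambda>_ge_1 unfolding drift_def by (simp add: abs_le_iff)
    have p: "0 < q\<^sup>2 * real k / 4" using q2 k_pos by simp
    have "0 < (1 - q\<^sup>2) * (real k - real (min_blocks False a))" using l p by linarith
    hence "0 < real k - real (min_blocks False a)" using q2 by (simp add: zero_less_mult_iff)
    hence "(1 - q\<^sup>2) * (real k - real (min_blocks False a)) \<le> 1 * (real k - real (min_blocks False a))"
      using q2 by (intro mult_right_mono) auto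
    with l show ?thesis unfolding mult_1 by (rule order_trans)
  qed
  have "0 \<le> q\<^sup>2 * real k / 4" using q2 k_pos by simp
  thus "min_blocks False a \<le> k" using * by linarith
  have "(1 - q\<^sup>2) * (real k - real (min_blocks False a)) \<le> (1 - q\<^sup>2) * real k"
    using q2 by (intro mult_left_mono) auto
  thus "q\<^sup>2 * real (length a) \<le> real k"
    using assms \<Lambda>_small \<Lambda>_ge_1 unfolding drift_def by (simp add: abs_le_iff algebra_simps)
qed

lemma window_\<rho>:
  assumes "\<bar>drift k a\<bar> \<le> 4 * \<Lambda>"
  shows "\<bar>\<rho> k a - 1\<bar> \<le> 20 * \<epsilon>"
proof -
  note b = window_bounds(1,3)[of a]
  let ?u = "real k - real (min_blocks False a) + 1"
  have u: "q\<^sup>2 * real k / 4 \<le> ?u" "0 < ?u" using b assms \<Lambda>_ge_1 by auto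
  have "\<bar>\<rho> k a - 1\<bar> = \<bar>drift k a - (1 - q\<^sup>2)\<bar> / ?u"
    using u by (subst \<rho>_drift) auto
  also have "\<dots> \<le> (5 * \<Lambda>) / (q\<^sup>2 * real k / 4)"
  proof (rule frac_le)
    show "\<bar>drift k a - (1 - q\<^sup>2)\<bar> \<le> 5 * \<Lambda>" using assms \<Lambda>_ge_1 q2 by linarith
  qed (use \<Lambda>_ge_1 q2 k_pos u in auto)
  also have "\<dots> = 20 * \<epsilon>" by (simp add: \<epsilon>_def)
  finally show ?thesis .
qed

text \<open>\<open>z\<close> arises from \<open>a\<close> and \<open>c\<close> by inserting two bits in between, which changes the number of blocks
  by a bounded amount.\<close>

definition spliced :: "bool list \<Rightarrow> bool list \<Rightarrow> bool list \<Rightarrow> bool" where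
  "spliced a c z \<longleftrightarrow> length z = length a + length c + 2 \<and>
     min_blocks False a + min_blocks False c \<le> min_blocks False z + 1 \<and> min_blocks False z \<le> min_blocks False a + min_blocks False c + 2"

lemma spliced_commute: "spliced a c z \<longleftrightarrow> spliced c a z"
  by (auto simp: spliced_def)

lemma spliced_take_drop:
  assumes "j + 2 \<le> length z"
  shows "spliced (take j z) (drop (j + 2) z) z"
proof -
  obtain a x y c where z: "z = a @ [x, y] @ c" "length a = j" using assms by (rule split_at_pair)
  have 1: "min_blocks False z = min_blocks False a + min_blocks (end_state False a) [x, y] + min_blocks (\<not> y) c"
    by (simp add: z min_blocks_append)
  have 2: "min_blocks (end_state False a) [x, y] \<le> 2" by simp
  have 3: "min_blocks (\<not> y) c \<le> min_blocks False c" "min_blocks False c \<le> Suc (min_blocks (\<not> y) c)"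
    using min_blocks_True_le[of c] min_blocks_state by (cases y; auto)+
  have "take j z = a" "drop (j + 2) z = c" using z by auto
  thus ?thesis using 1 2 3 by (auto simp: spliced_def z(1)) 
qed

lemma abs_drift_bound:
  fixes b :: real
  assumes "l = x + y + 2 * b - e" "\<bar>e\<bar> \<le> 2 - 2 * b" "\<bar>x\<bar> \<le> 4 * M" "\<bar>y\<bar> \<le> 4 * M" "1 \<le> M" "0 < b" "b < 1"
  shows "\<bar>l - (1 - b)\<bar> \<le> 11 * M"
proof -
  have "e \<le> 2 - 2 * b" "- e \<le> 2 - 2 * b" using assms(2) by linarith+
  moreover have "x \<le> 4 * M" "- x \<le> 4 * M" "y \<le> 4 * M" "- y \<le> 4 * M" using assms(3,4) by linarith+
  ultimately show ?thesis unfolding abs_le_iff using assms(1,5-7) by linarith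
qed

text \<open>Drifts add up under splicing, except for a bounded error from the two inserted bits, the
  extra block and the change of state. Hence \<open>z\<close> is typical for
  \<open>2 * k + 1\<close> blocks once \<open>a\<close> and \<open>c\<close> are typical for
  \<open>k\<close>.\<close>

lemma window_splice:
  assumes s: "spliced a c z" and a: "\<bar>drift k a\<bar> \<le> 4 * \<Lambda>" and c: "\<bar>drift k c\<bar> \<le> 4 * \<Lambda>"
  shows "min_blocks False z \<le> 2 * k + 1" and "\<bar>\<rho> (2 * k + 1) z - 1\<bar> \<le> 22 * \<epsilon>"
proof -
  define d where "d = real (min_blocks False z) - real (min_blocks False a) - real (min_blocks False c)"
  have d: "-1 \<le> d" "d \<le> 2" using s by (auto simp: spliced_def d_def)
  have ba: "q\<^sup>2 * real k / 4 \<le> real k - real (min_blocks False a)" using window_bounds(1)[of a] a \<Lambda>_ge_1 by auto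
  have bc: "q\<^sup>2 * real k / 4 \<le> real k - real (min_blocks False c)" using window_bounds(1)[of c] c \<Lambda>_ge_1 by auto
  have uz: "real (2 * k + 1) - real (min_blocks False z) = (real k - real (min_blocks False a)) + (real k - real (min_blocks False c)) + 1 - d"
    by (simp add: d_def)
  have big: "1000 \<le> q\<^sup>2 * real k" using \<Lambda>_ge_1 \<Lambda>_small by linarith
  have u: "q\<^sup>2 * real k / 2 \<le> real (2 * k + 1) - real (min_blocks False z) + 1" using uz ba bc d by linarith
  show "min_blocks False z \<le> 2 * k + 1" using u big by linarith
  define e where "e = (1 - q\<^sup>2) * (1 - d)"
  define l where "l = drift (2 * k + 1) z"
  have "l = drift k a + drift k c + 2 * q\<^sup>2 - e"
    using s by (simp add: drift_def spliced_def d_def e_def l_def algebra_simps)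
  moreover have "\<bar>e\<bar> \<le> 2 - 2 * q\<^sup>2"
  proof -
    have "\<bar>e\<bar> \<le> (1 - q\<^sup>2) * 2"
      unfolding e_def abs_mult using d q2 by (intro mult_mono) auto
    thus ?thesis by (simp add: algebra_simps)
  qed
  ultimately have "\<bar>l - (1 - q\<^sup>2)\<bar> \<le> 11 * \<Lambda>"
    using a c \<Lambda>_ge_1 q2 by (intro abs_drift_bound)
  hence l: "\<bar>drift (2 * k + 1) z - (1 - q\<^sup>2)\<bar> \<le> 11 * \<Lambda>" by (simp only: l_def)
  have "\<bar>\<rho> (2 * k + 1) z - 1\<bar> = \<bar>drift (2 * k + 1) z - (1 - q\<^sup>2)\<bar> / (real (2 * k + 1) - real (min_blocks False z) + 1)"
    using u big by (subst \<rho>_drift) auto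
  also have "\<dots> \<le> (11 * \<Lambda>) / (q\<^sup>2 * real k / 2)"
    by (rule frac_le) (use l u big \<Lambda>_ge_1 in auto)
  also have "\<dots> = 22 * \<epsilon>" by (simp add: \<epsilon>_def)
  finally show "\<bar>\<rho> (2 * k + 1) z - 1\<bar> \<le> 22 * \<epsilon>" .
qed

text \<open>A Lipschitz cutoff instead of an indicator: a change of the drift by at most 1 changes
  it by at most 1/\<open>\<Lambda>\<close>, which is at most \<open>\<epsilon>\<close>.\<close>

definition cut :: "bool list \<Rightarrow> real" where
  "cut a = max 0 (min 1 (2 - \<bar>drift k a\<bar> / \<Lambda>))"

lemma cut_bounds: "0 \<le> cut a" "cut a \<le> 1"
  by (auto simp: cut_def)

lemma cut_eq_0: "2 * \<Lambda> \<le> \<bar>drift k a\<bar> \<Longrightarrow> cut a = 0"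
  using \<Lambda>_ge_1 by (auto simp: cut_def field_simps)

lemma cut_eq_1: "\<bar>drift k a\<bar> \<le> \<Lambda> \<Longrightarrow> cut a = 1"
proof -
  assume "\<bar>drift k a\<bar> \<le> \<Lambda>"
  hence "\<bar>drift k a\<bar> / \<Lambda> \<le> 1" using \<Lambda>_ge_1 by simp
  thus ?thesis by (simp add: cut_def)
qed

lemma cut_lipschitz: "\<bar>cut a - cut a'\<bar> \<le> \<bar>drift k a - drift k a'\<bar> / \<Lambda>"
proof -
  have "\<bar>cut a - cut a'\<bar> \<le> \<bar>\<bar>drift k a\<bar> / \<Lambda> - \<bar>drift k a'\<bar> / \<Lambda>\<bar>"
    unfolding cut_def by linarith
  also have "\<dots> = \<bar>\<bar>drift k a\<bar> - \<bar>drift k a'\<bar>\<bar> / \<Lambda>"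
    using \<Lambda>_ge_1 by (simp add: diff_divide_distrib[symmetric] abs_divide)
  also have "\<dots> \<le> \<bar>drift k a - drift k a'\<bar> / \<Lambda>"
    using \<Lambda>_ge_1 by (intro divide_right_mono) auto
  finally show ?thesis .
qed

text \<open>Up to a constant, the share of one splitting of \<open>z\<close> in the law of a trace
  of \<open>alt (2 * k + 1)\<close>.\<close>

definition H :: "bool list \<Rightarrow> bool list \<Rightarrow> bool list \<Rightarrow> real" where
  "H a c z = A k a * A k c / A (2 * k + 1) z"

text \<open>The truncated term of the difference relative to \<open>A (2 * k + 1)\<close>. The two
  products nearly cancel: by \<open>F_eq_H\<close> a difference of two likelihood ratios remains.
  The antisymmetry in \<open>a\<close> and \<open>c\<close> halves the later case analysis.\<close>

definition F :: "bool list \<Rightarrow> bool list \<Rightarrow> bool list \<Rightarrow> real" where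
  "F a c z = cut a * cut c * (A k a * A (Suc k) c - A (Suc k) a * A k c) / A (2 * k + 1) z"

lemma H_commute: "H a c z = H c a z" and F_commute: "F a c z = - F c a z"
  by (auto simp: H_def F_def divide_simps algebra_simps)

lemma H_nonneg: "0 \<le> H a c z"
  by (simp add: H_def trace_prob_nonneg)

lemma F_eq_H:
  assumes "min_blocks False a \<le> k" "min_blocks False c \<le> k"
  shows "F a c z = cut a * cut c * H a c z * (\<rho> k c - \<rho> k a)"
  by (simp add: F_def H_def A_Suc[OF assms(1)] A_Suc[OF assms(2)] algebra_simps)

lemma F_bound:
  shows "\<bar>F a c z\<bar> \<le> 40 * \<epsilon> * H a c z"
proof (cases "\<bar>drift k a\<bar> \<le> 2 * \<Lambda> \<and> \<bar>drift k c\<bar> \<le> 2 * \<Lambda>")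
  case True
  hence "min_blocks False a \<le> k" "min_blocks False c \<le> k" using window_bounds(3) \<Lambda>_ge_1 by auto
  hence "\<bar>F a c z\<bar> = (cut a * cut c) * (H a c z * \<bar>\<rho> k c - \<rho> k a\<bar>)"
    using cut_bounds H_nonneg by (simp add: F_eq_H abs_mult)
  also have "\<dots> \<le> 1 * (H a c z * \<bar>\<rho> k c - \<rho> k a\<bar>)"
    using cut_bounds H_nonneg by (intro mult_right_mono mult_le_one) auto
  also have "\<dots> \<le> 1 * (H a c z * (40 * \<epsilon>))"
    using window_\<rho>[of a] window_\<rho>[of c] True \<Lambda>_ge_1 H_nonneg
    by (intro mult_left_mono) (linarith | simp)+
  finally show ?thesis by (simp add: mult.commute)
next
  case False
  hence "cut a = 0 \<or> cut c = 0" using cut_eq_0[of a] cut_eq_0[of c] by linarith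
  hence "F a c z = 0" by (auto simp: F_def)
  thus ?thesis using H_nonneg \<epsilon> by simp
qed

lemma inverse_k_le: "1 / real k \<le> (q\<^sup>2 * \<epsilon>)\<^sup>2"
proof -
  have "1 / real k = real k / (real k)\<^sup>2" by (simp add: power2_eq_square)
  also have "\<dots> \<le> \<Lambda>\<^sup>2 / (real k)\<^sup>2" by (intro divide_right_mono k_le_\<Lambda>) simp
  also have "\<dots> = (q\<^sup>2 * \<epsilon>)\<^sup>2" using q2 by (simp add: \<epsilon>_def power_divide)
  finally show ?thesis .
qed

lemma inverse_\<Lambda>_le: "1 / \<Lambda> \<le> \<epsilon>"
proof -
  have "q\<^sup>2 * real k \<le> real k" using q2 k_pos by simp
  also have "\<dots> \<le> \<Lambda> * \<Lambda>" using k_le_\<Lambda> by (simp add: power2_eq_square)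
  finally show ?thesis using \<Lambda>_ge_1 q2 k_pos by (simp add: \<epsilon>_def field_simps)
qed

text \<open>\<open>F\<close> is the product of a cutoff, of \<open>H\<close> and of a difference
  \<open>y\<close> of likelihood ratios. When one block less is needed, the cutoff and
  \<open>H\<close> change by relative amounts \<open>O(\<epsilon>)\<close>, \<open>y\<close> is
  \<open>O(\<epsilon>)\<close> and changes only by \<open>O(\<epsilon>^2)\<close>; so the product
  changes by \<open>O(\<epsilon>^2)\<close> times \<open>H\<close>.\<close>

lemma F_shift_aux:
  assumes len: "length a' = length a" "length z' = length z"
    and r: "min_blocks False a = Suc (min_blocks False a')" "min_blocks False z = Suc (min_blocks False z')"
    and s: "spliced a c z" and a: "\<bar>drift k a\<bar> \<le> 4 * \<Lambda>" and c: "\<bar>drift k c\<bar> \<le> 4 * \<Lambda>"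
  shows "H a' c z' \<le> 2 * H a c z" "H a c z \<le> 2 * H a' c z'"
    and "\<bar>F a' c z' - F a c z\<bar> \<le> 2100 * \<epsilon>\<^sup>2 * H a c z"
proof -
  have ra: "min_blocks False a \<le> k" and rc: "min_blocks False c \<le> k" using window_bounds(3) a c \<Lambda>_ge_1 by auto
  have ra': "min_blocks False a' \<le> k" using ra r by simp
  note zz = window_splice[OF s a c]
  have pa: "\<bar>\<rho> k a - 1\<bar> \<le> 20 * \<epsilon>" and pc: "\<bar>\<rho> k c - 1\<bar> \<le> 20 * \<epsilon>"
    using window_\<rho> a c by auto
  \<comment> \<open>Numerator and denominator of \<open>H\<close> both gain a factor
    \<open>\<rho> / q^2\<close>. The powers of q cancel, and a quotient of two numbers close to 1
    remains.\<close>
  define h where "h = \<rho> k a / \<rho> (2 * k + 1) z"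
  have pz: "9 / 10 \<le> \<rho> (2 * k + 1) z" using zz(2) \<epsilon> unfolding abs_le_iff by linarith
  have Hh: "H a' c z' = H a c z * h"
    unfolding H_def h_def A_rank_shift[OF len(1) r(1) ra] A_rank_shift[OF len(2) r(2) zz(1)]
    using q2 by (simp add: field_simps)
  have "\<bar>h - 1\<bar> = \<bar>\<rho> k a - \<rho> (2 * k + 1) z\<bar> / \<rho> (2 * k + 1) z"
    using pz by (simp add: h_def diff_divide_distrib[symmetric] abs_divide field_simps)
  also have "\<dots> \<le> (42 * \<epsilon>) / (9 / 10)"
    by (rule frac_le) (use pz pa zz(2) \<epsilon> in auto)
  finally have h: "\<bar>h - 1\<bar> \<le> 50 * \<epsilon>" using \<epsilon> by simp
  have h2: "1 / 2 \<le> h" "h \<le> 2" using h \<epsilon> unfolding abs_le_iff by linarith+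
  show "H a' c z' \<le> 2 * H a c z" unfolding Hh
    using mult_left_mono[OF h2(2) H_nonneg[of a c z]] by simp
  show "H a c z \<le> 2 * H a' c z'" unfolding Hh
    using mult_left_mono[OF h2(1) H_nonneg[of a c z]] by simp
  define y where "y = \<rho> k c - \<rho> k a"
  define y' where "y' = \<rho> k c - \<rho> k a'"
  have y: "\<bar>y\<bar> \<le> 40 * \<epsilon>" unfolding y_def using pa pc by linarith
  have yy: "\<bar>y' - y\<bar> \<le> 16 * \<epsilon>\<^sup>2"
  proof -
    define u where "u = real k - real (min_blocks False a)"
    have u: "q\<^sup>2 * real k / 4 \<le> u" using window_bounds(1)[of a] a \<Lambda>_ge_1 by (auto simp: u_def)
    have p: "0 < q\<^sup>2 * real k / 4" using q2 k_pos by simp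
    have u0: "0 < u" using u p by linarith
    have u': "real k - real (min_blocks False a') = u + 1" using r by (simp add: u_def)
    \<comment> \<open>The change of a likelihood ratio under a unit shift has denominator of order
      k^2 and numerator of order k, hence is of order 1/k.\<close>
    have "y' - y = q\<^sup>2 * (u + 1 + real (length a)) / (u + 1) - q\<^sup>2 * (u + 1 + 1 + real (length a)) / (u + 1 + 1)"
      unfolding y_def y'_def \<rho>_def len u' u_def[symmetric] by simp
    also have "\<dots> = q\<^sup>2 * real (length a) / ((u + 1) * (u + 1 + 1))"
      using u0 by (simp add: field_simps)
    finally have "\<bar>y' - y\<bar> = q\<^sup>2 * real (length a) / ((u + 1) * (u + 1 + 1))" using u0 q2 by simp
    also have "\<dots> \<le> real k / ((q\<^sup>2 * real k / 4) * (q\<^sup>2 * real k / 4))"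
    proof (rule frac_le)
      show "(q\<^sup>2 * real k / 4) * (q\<^sup>2 * real k / 4) \<le> (u + 1) * (u + 1 + 1)"
        by (rule mult_mono) (use u p in linarith)+
      show "0 < (q\<^sup>2 * real k / 4) * (q\<^sup>2 * real k / 4)" by (rule mult_pos_pos) (rule p)+
    qed (use window_bounds(2)[of a] a \<Lambda>_ge_1 in auto)
    also have "\<dots> = 16 * (1 / real k) / (q\<^sup>2)\<^sup>2"
      using k_pos q2 by (simp add: field_simps power2_eq_square)
    also have "\<dots> \<le> 16 * (q\<^sup>2 * \<epsilon>)\<^sup>2 / (q\<^sup>2)\<^sup>2"
      by (intro divide_right_mono mult_left_mono inverse_k_le) auto
    also have "\<dots> = 16 * \<epsilon>\<^sup>2" using q2 by (simp add: power_mult_distrib)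
    finally show ?thesis .
  qed
  define x where "x = cut a * cut c"
  define x' where "x' = cut a' * cut c"
  have x': "0 \<le> x'" "x' \<le> 1" unfolding x'_def using cut_bounds by (auto intro: mult_le_one)
  have xx: "\<bar>x' - x\<bar> \<le> \<epsilon>"
  proof -
    have "\<bar>x' - x\<bar> = \<bar>cut a' - cut a\<bar> * cut c"
      using cut_bounds by (simp add: x_def x'_def abs_mult left_diff_distrib[symmetric])
    also have "\<dots> \<le> \<bar>cut a' - cut a\<bar> * 1" using cut_bounds by (intro mult_left_mono) auto
    also have "\<dots> \<le> \<bar>drift k a' - drift k a\<bar> / \<Lambda>" using cut_lipschitz[of a' a] by simp
    also have "\<dots> \<le> 1 / \<Lambda>"
      using r len q2 \<Lambda>_ge_1 by (intro divide_right_mono) (auto simp: drift_def algebra_simps)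
    finally show ?thesis using inverse_\<Lambda>_le by linarith
  qed
  \<comment> \<open>The factors are replaced one at a time; the three errors add up to 32 + 2000 +
    40 times \<open>\<epsilon>^2\<close>, below 2100.\<close>
  have "\<bar>x' * h * (y' - y)\<bar> \<le> 1 * 2 * (16 * \<epsilon>\<^sup>2)"
    unfolding abs_mult using x' h2 yy by (intro mult_mono) auto
  moreover have "\<bar>x' * (h - 1) * y\<bar> \<le> 1 * (50 * \<epsilon>) * (40 * \<epsilon>)"
    unfolding abs_mult using x' h y \<epsilon> by (intro mult_mono) auto
  moreover have "\<bar>(x' - x) * y\<bar> \<le> \<epsilon> * (40 * \<epsilon>)"
    unfolding abs_mult using xx y \<epsilon> by (intro mult_mono) auto
  moreover have "x' * h * y' - x * y = x' * h * (y' - y) + x' * (h - 1) * y + (x' - x) * y"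
    by (simp add: algebra_simps)
  ultimately have *: "\<bar>x' * h * y' - x * y\<bar> \<le> 2100 * \<epsilon>\<^sup>2"
    unfolding power2_eq_square by linarith
  have "F a' c z' - F a c z = H a c z * (x' * h * y' - x * y)"
    unfolding F_eq_H[OF ra rc] F_eq_H[OF ra' rc] Hh x_def x'_def y_def y'_def by (simp add: algebra_simps)
  hence "\<bar>F a' c z' - F a c z\<bar> = H a c z * \<bar>x' * h * y' - x * y\<bar>"
    using H_nonneg by (simp add: abs_mult)
  also have "\<dots> \<le> H a c z * (2100 * \<epsilon>\<^sup>2)"
    using * H_nonneg by (rule mult_left_mono)
  finally show "\<bar>F a' c z' - F a c z\<bar> \<le> 2100 * \<epsilon>\<^sup>2 * H a c z" by (simp add: mult.commute)
qed

text \<open>The drift of \<open>a\<close> moves by at most 1, so outside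
  \<open>3 * \<Lambda>\<close> the cutoffs vanish before and after. For \<open>d = 1\<close> the
  roles of the two words are exchanged in \<open>F_shift_aux\<close>, and returning from
  \<open>H a' c z'\<close> to \<open>H a c z\<close> doubles the constant.\<close>

lemma F_shift:
  assumes len: "length a' = length a" "length z' = length z"
    and d: "\<bar>d\<bar> \<le> 1" "int (min_blocks False a') = int (min_blocks False a) + d" "int (min_blocks False z') = int (min_blocks False z) + d"
    and s: "spliced a c z"
  shows "\<bar>F a c z - F a' c z'\<bar> \<le>
    (if \<bar>drift k a\<bar> \<le> 3 * \<Lambda> \<and> \<bar>drift k c\<bar> \<le> 3 * \<Lambda> then 4200 * \<epsilon>\<^sup>2 * H a c z else 0)"
proof -
  have la: "\<bar>drift k a - drift k a'\<bar> \<le> \<Lambda>"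
  proof -
    have rr: "real (min_blocks False a') = real (min_blocks False a) + real_of_int d" using d(2) by linarith
    have "drift k a - drift k a' = - ((1 - q\<^sup>2) * real_of_int d)"
      by (simp add: drift_def len rr algebra_simps)
    hence "\<bar>drift k a - drift k a'\<bar> = (1 - q\<^sup>2) * \<bar>real_of_int d\<bar>"
      using q2 by (simp add: abs_mult)
    also have "\<dots> \<le> 1 * 1" using q2 d(1) by (intro mult_mono) auto
    finally show ?thesis using \<Lambda>_ge_1 by simp
  qed
  show ?thesis
  proof (cases "\<bar>drift k a\<bar> \<le> 3 * \<Lambda> \<and> \<bar>drift k c\<bar> \<le> 3 * \<Lambda>")
    case False
    hence "(cut a = 0 \<and> cut a' = 0) \<or> cut c = 0"
      using cut_eq_0[of a] cut_eq_0[of a'] cut_eq_0[of c] la \<Lambda>_ge_1 by linarith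
    hence "F a c z = 0" "F a' c z' = 0" by (auto simp: F_def)
    thus ?thesis using H_nonneg[of a c z] by simp
  next
    case True
    have a': "\<bar>drift k a'\<bar> \<le> 4 * \<Lambda>" using True la by linarith
    have s': "spliced a' c z'" using s len d by (auto simp: spliced_def)
    have nn: "0 \<le> \<epsilon>\<^sup>2 * H a c z" using H_nonneg by simp
    consider "d = -1" | "d = 0" | "d = 1" using d(1) by linarith
    thus ?thesis
    proof cases
      case 1
      have "min_blocks False a = Suc (min_blocks False a')" "min_blocks False z = Suc (min_blocks False z')" using 1 d by linarith+
      from F_shift_aux(3)[OF len this s] True \<Lambda>_ge_1 nn show ?thesis by auto
    next
      case 2
      have "A m a' = A m a" "A m z' = A m z" for m
        using 2 d len by (auto simp: trace_prob_alt)
      moreover have "drift k a' = drift k a" using 2 d len by (auto simp: drift_def)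
      ultimately have "F a' c z' = F a c z" by (simp add: F_def cut_def)
      thus ?thesis using True H_nonneg[of a c z] by simp
    next
      case 3
      have "min_blocks False a' = Suc (min_blocks False a)" "min_blocks False z' = Suc (min_blocks False z)" using 3 d by linarith+
      note X = F_shift_aux[OF len[symmetric] this s' a']
      have c: "\<bar>drift k c\<bar> \<le> 4 * \<Lambda>" using True \<Lambda>_ge_1 by linarith
      have "\<bar>F a c z - F a' c z'\<bar> \<le> 2100 * \<epsilon>\<^sup>2 * H a' c z'" using X(3) c by simp
      also have "\<dots> \<le> 2100 * \<epsilon>\<^sup>2 * (2 * H a c z)" using X(2) c by (intro mult_left_mono) auto
      finally show ?thesis using True by simp
    qed
  qed
qed

end

section \<open>The mass carried by one position of the trace\<close>

lemma embeddings_0: "embeddings 0 r n = (if r = 0 then 1 else 0)"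
  by (simp add: embeddings_def)

text \<open>As a sequence in \<open>t\<close>, \<open>embeddings t r i\<close> has the generating
  function x^r / (1-x)^(i+1), and these functions multiply. The proof is a double induction on
  \<open>n\<close> and \<open>i\<close> by Pascal's rule.\<close>

lemma embeddings_vandermonde:
  "(\<Sum>t\<le>n. embeddings t r i * embeddings (n - t) r' i') = embeddings n (r + r') (Suc (i + i'))"
proof (induction n arbitrary: i)
  case 0
  show ?case by (simp add: embeddings_0)
next
  case (Suc n)
  note outer = Suc.IH
  show ?case
  proof (induction i)
    case 0
    have embeddings_r_0: "embeddings t r 0 = (if r \<le> t then 1 else 0)" for t by (simp add: embeddings_def)
    have "(\<Sum>t\<le>Suc n. embeddings t r 0 * embeddings (Suc n - t) r' i') =
        (\<Sum>t\<le>n. embeddings t r 0 * embeddings (n - t) r' i') + embeddings (Suc n) (r + r') i'"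
    proof (cases "r \<le> Suc n")
      case True
      have "(\<Sum>t\<le>Suc n. embeddings t r 0 * embeddings (Suc n - t) r' i') = (\<Sum>t=r..Suc n. embeddings (Suc n - t) r' i')"
        unfolding embeddings_r_0 by (rule sum.mono_neutral_cong_right) auto
      \<comment> \<open>The term \<open>t = r\<close> is split off, and shifting the index turns the
        rest into the sum for \<open>n\<close>.\<close>
      also have "\<dots> = embeddings (Suc n - r) r' i' + (\<Sum>t=Suc r..Suc n. embeddings (Suc n - t) r' i')"
        using True by (simp add: sum.atLeast_Suc_atMost)
      also have "(\<Sum>t=Suc r..Suc n. embeddings (Suc n - t) r' i') = (\<Sum>t=r..n. embeddings (n - t) r' i')"
        by (subst sum.shift_bounds_cl_Suc_ivl) simp
      also have "\<dots> = (\<Sum>t\<le>n. embeddings t r 0 * embeddings (n - t) r' i')"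
        unfolding embeddings_r_0 by (rule sum.mono_neutral_cong_left) auto
      also have "embeddings (Suc n - r) r' i' = embeddings (Suc n) (r + r') i'"
        using True by (simp add: embeddings_def) (auto simp: add.commute)
      finally show ?thesis by simp
    next
      case False
      thus ?thesis by (simp add: embeddings_def)
    qed
    also have "\<dots> = embeddings n (r + r') (Suc i') + embeddings (Suc n) (r + r') i'"
      using outer[of 0] by simp
    finally show ?case using embeddings_pascal[of n "r + r'" i'] by simp
  next
    case (Suc i)
    have "(\<Sum>t\<le>Suc n. embeddings t r (Suc i) * embeddings (Suc n - t) r' i') =
        embeddings 0 r (Suc i) * embeddings (Suc n) r' i' + (\<Sum>t\<le>n. embeddings (Suc t) r (Suc i) * embeddings (n - t) r' i')"
      by (subst sum.atMost_Suc_shift) simp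
    also have "\<dots> = (\<Sum>t\<le>n. embeddings t r (Suc i) * embeddings (n - t) r' i') +
        (embeddings 0 r i * embeddings (Suc n) r' i' + (\<Sum>t\<le>n. embeddings (Suc t) r i * embeddings (n - t) r' i'))"
      by (simp add: embeddings_pascal sum.distrib ring_distribs embeddings_0)
    also have "embeddings 0 r i * embeddings (Suc n) r' i' + (\<Sum>t\<le>n. embeddings (Suc t) r i * embeddings (n - t) r' i')
        = (\<Sum>t\<le>Suc n. embeddings t r i * embeddings (Suc n - t) r' i')"
      by (subst sum.atMost_Suc_shift) simp
    also have "\<dots> = embeddings (Suc n) (r + r') (Suc (i + i'))" by (rule Suc)
    also have "(\<Sum>t\<le>n. embeddings t r (Suc i) * embeddings (n - t) r' i') = embeddings n (r + r') (Suc (Suc i + i'))"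
      by (rule outer)
    finally show ?case using embeddings_pascal[of n "r + r'" "Suc (i + i')"] by simp
  qed
qed

lemma embeddings_antimono: "r \<le> r' \<Longrightarrow> embeddings k r' n \<le> embeddings k r n"
  by (auto simp: embeddings_def intro!: binomial_right_mono)

lemma embeddings_Suc_rank:
  assumes "r \<le> k"
  shows "embeddings k (Suc r) (Suc n) * real (Suc n) = embeddings k r n * (real k - real r)"
proof -
  define u where "u = k - r"
  have k: "k = u + r" using assms by (simp add: u_def)
  show ?thesis
  proof (cases u)
    case 0
    thus ?thesis using k by (simp add: embeddings_def)
  next
    case (Suc v)
    have "((v + Suc n) choose Suc n) * Suc n = ((v + Suc n) choose n) * Suc v"
      using binomial_absorb_comp[of "v + Suc n" n] binomial_absorption[of n "v + Suc n"]
      by (simp add: mult.commute)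
    hence "real ((v + Suc n) choose Suc n) * real (Suc n) = real ((v + Suc n) choose n) * real (Suc v)"
      by (metis of_nat_mult)
    moreover have "k - Suc r + Suc n = v + Suc n" "k - r + n = v + Suc n" using k Suc by auto
    ultimately show ?thesis using k Suc by (simp add: embeddings_def)
  qed
qed

text \<open>A word with a marked position is determined by its two outer parts and the two bits
  between them, which leaves four choices for each pair of parts.\<close>

lemma sum_splices_le:
  fixes f :: "bool list \<Rightarrow> bool list \<Rightarrow> real"
  assumes "\<And>a c. 0 \<le> f a c"
  shows "(\<Sum>z\<in>lists_upto L. \<Sum>j\<le>L. if j + 2 \<le> length z then f (take j z) (drop (j + 2) z) else 0)
    \<le> 4 * (\<Sum>a\<in>lists_upto L. \<Sum>c\<in>lists_upto L. f a c)"
proof -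
  let ?Z = "lists_upto L"
  let ?D = "{p \<in> ?Z \<times> {..L}. snd p + 2 \<le> length (fst p)}"
  let ?T = "(?Z \<times> ?Z) \<times> (UNIV :: (bool \<times> bool) set)"
  let ?i = "\<lambda>((a, c), (x, y)). (a @ [x, y] @ c, length a)"
  have "(\<Sum>z\<in>?Z. \<Sum>j\<le>L. if j + 2 \<le> length z then f (take j z) (drop (j + 2) z) else 0) =
      (\<Sum>p\<in>?Z \<times> {..L}. if snd p + 2 \<le> length (fst p) then f (take (snd p) (fst p)) (drop (snd p + 2) (fst p)) else 0)"
    by (simp add: sum.cartesian_product case_prod_unfold)
  also have "\<dots> = (\<Sum>p\<in>?D. f (take (snd p) (fst p)) (drop (snd p + 2) (fst p)))"
    by (rule sum.inter_filter[symmetric]) simp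
  also have "\<dots> \<le> (\<Sum>t\<in>?T. f (fst (fst t)) (snd (fst t)))"
  proof (rule sum_le_included[where i = ?i])
    show "\<forall>p\<in>?D. \<exists>t\<in>?T. ?i t = p \<and> f (take (snd p) (fst p)) (drop (snd p + 2) (fst p)) \<le> f (fst (fst t)) (snd (fst t))"
    proof
      fix p assume p: "p \<in> ?D"
      then obtain z j where pz: "p = (z, j)" "length z \<le> L" "j + 2 \<le> length z" by (cases p) auto
      from pz(3) obtain a x y c where z: "z = a @ [x, y] @ c" "length a = j" by (rule split_at_pair)
      show "\<exists>t\<in>?T. ?i t = p \<and> f (take (snd p) (fst p)) (drop (snd p + 2) (fst p)) \<le> f (fst (fst t)) (snd (fst t))"
        by (rule bexI[of _ "((a, c), (x, y))"]) (use pz z in auto)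
    qed
  qed (use assms in auto)
  also have "\<dots> = (\<Sum>p\<in>?Z \<times> ?Z. \<Sum>w\<in>(UNIV :: (bool \<times> bool) set). f (fst p) (snd p))"
    by (subst sum.cartesian_product) (simp add: case_prod_unfold)
  also have "\<dots> = 4 * (\<Sum>p\<in>?Z \<times> ?Z. f (fst p) (snd p))"
    by (simp add: sum_distrib_left)
  also have "\<dots> = 4 * (\<Sum>a\<in>?Z. \<Sum>c\<in>?Z. f a c)"
    by (simp add: sum.cartesian_product case_prod_unfold)
  finally show ?thesis .
qed

context deletion
begin

lemma trace_prob_Cons_ge:
  "q * trace_prob q x z \<le> trace_prob q (b # x) z"
  "(1 - q) * trace_prob q x z \<le> trace_prob q (b # x) (b # z)"
  using q0 q1 by (auto simp: trace_prob_nonneg split: list.splits)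

text \<open>Every two-bit word is a subsequence of \<open>0101\<close>: retain these two bits of two
  additional blocks and delete the other two.\<close>

lemma A_insert_pair: "(1 - q)\<^sup>2 * q\<^sup>2 * A m c \<le> A (Suc (Suc m)) (x # y # c)"
proof -
  have mono: "u * (v * t) \<le> w" if "u * s \<le> w" "v * t \<le> s" "0 \<le> u" for u v s t w :: real
    using that by (meson mult_left_mono order_trans)
  have pq: "0 \<le> q" "0 \<le> 1 - q" using q0 q1 by auto
  note I = mono[OF trace_prob_Cons_ge(1) _ pq(1)] mono[OF trace_prob_Cons_ge(2) _ pq(2)]
  consider "\<not> x \<and> \<not> y" | "\<not> x \<and> y" | "x \<and> \<not> y" | "x \<and> y" by blast
  thus ?thesis
  proof cases
    case 1
    have "(1 - q) * (q * ((1 - q) * (q * A m c))) \<le> trace_prob q (False # True # False # True # alt m) (False # False # c)"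
      by (intro I trace_prob_Cons_ge(1))
    thus ?thesis using 1 by (simp add: alt_Suc power2_eq_square mult_ac del: trace_prob.simps)
  next
    case 2
    have "(1 - q) * ((1 - q) * (q * (q * A m c))) \<le> trace_prob q (False # True # False # True # alt m) (False # True # c)"
      by (intro I trace_prob_Cons_ge(1))
    thus ?thesis using 2 by (simp add: alt_Suc power2_eq_square mult_ac del: trace_prob.simps)
  next
    case 3
    have "q * ((1 - q) * ((1 - q) * (q * A m c))) \<le> trace_prob q (False # True # False # True # alt m) (True # False # c)"
      by (intro I trace_prob_Cons_ge(1))
    thus ?thesis using 3 by (simp add: alt_Suc power2_eq_square mult_ac del: trace_prob.simps)
  next
    case 4
    have "q * ((1 - q) * (q * ((1 - q) * A m c))) \<le> trace_prob q (False # True # False # True # alt m) (True # True # c)"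
      by (intro I trace_prob_Cons_ge(2))
    thus ?thesis using 4 by (simp add: alt_Suc power2_eq_square mult_ac del: trace_prob.simps)
  qed
qed

text \<open>\<open>C1\<close> bounds the total share of all positions,
  \<open>C2 * \<epsilon>\<close> the share of a single one. The two summands of \<open>C3\<close>
  come from pairs of near and of distant positions.\<close>

definition C1 :: real where "C1 = 2 / ((1 - q)\<^sup>2 * q\<^sup>2)"
definition C2 :: real where "C2 = exp (75 / q\<^sup>2) * (8 / ((1 - q)\<^sup>2 * q\<^sup>2))"
definition C3 :: real where "C3 = 8000 * C1 * C2 + 84000 * C1\<^sup>2"

lemma C1_pos: "0 < C1" and C2_pos: "0 < C2"
  using q0 q1 by (auto simp: C1_def C2_def)

end

context window
begin

text \<open>While at most \<open>\<Lambda>\<close> blocks are removed, the drift stays below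
  \<open>5 * \<Lambda>\<close> and the number of spare blocks stays of order k, so that each ratio
  is at most \<open>1 + 25 * \<epsilon>\<close>.\<close>

lemma A_le_A_down:
  assumes a: "\<bar>drift k a\<bar> \<le> 4 * \<Lambda>" and s: "real s \<le> \<Lambda>"
  shows "A k a \<le> (1 + 25 * \<epsilon>) ^ s * A (k - s) a"
  using s
proof (induction s)
  case (Suc s)
  define m where "m = k - Suc s"
  have b: "q\<^sup>2 * real k / 4 \<le> real k - real (min_blocks False a)" using window_bounds(1)[of a] a \<Lambda>_ge_1 by auto
  have "0 \<le> real (min_blocks False a)" by simp
  hence "real (Suc s) < real k" using b Suc.prems \<Lambda>_small \<Lambda>_ge_1 by linarith
  hence m: "k = m + Suc s" "k - s = Suc m" by (auto simp: m_def)
  let ?u = "real m - real (min_blocks False a) + 1"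
  have u: "q\<^sup>2 * real k / 5 \<le> ?u"
    using b Suc.prems \<Lambda>_small \<Lambda>_ge_1 m(1) by linarith
  have u0: "1 < ?u" using u \<Lambda>_small \<Lambda>_ge_1 by linarith
  have "(1 - q\<^sup>2) * real s \<le> 1 * \<Lambda>" by (rule mult_mono) (use q2 Suc.prems in auto)
  moreover have "drift m a - (1 - q\<^sup>2) = drift k a + (1 - q\<^sup>2) * real s"
    using drift_shift[of m "Suc s" a] unfolding m(1)[symmetric] by (simp add: algebra_simps)
  ultimately have l: "drift m a - (1 - q\<^sup>2) \<le> 5 * \<Lambda>" using a by linarith
  have "(drift m a - (1 - q\<^sup>2)) / ?u \<le> 5 * \<Lambda> / (q\<^sup>2 * real k / 5)"
  proof (rule order_trans)
    show "(drift m a - (1 - q\<^sup>2)) / ?u \<le> 5 * \<Lambda> / ?u"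
      using l u0 by (intro divide_right_mono) auto
    show "5 * \<Lambda> / ?u \<le> 5 * \<Lambda> / (q\<^sup>2 * real k / 5)"
      using u u0 k_pos q2 \<Lambda>_ge_1 by (intro divide_left_mono mult_pos_pos) auto
  qed
  also have "\<dots> = 25 * \<epsilon>" by (simp add: \<epsilon>_def)
  finally have "\<rho> m a \<le> 1 + 25 * \<epsilon>" using u0 by (subst \<rho>_drift) auto
  moreover have "A (k - s) a = A m a * \<rho> m a"
    unfolding m(2) by (rule A_Suc) (use u0 in linarith)
  ultimately have "A (k - s) a \<le> (1 + 25 * \<epsilon>) * A m a"
    using mult_right_mono[OF _ trace_prob_nonneg[of "alt m" a], of "\<rho> m a" "1 + 25 * \<epsilon>"] by (simp add: mult.commute)
  hence "(1 + 25 * \<epsilon>) ^ s * A (k - s) a \<le> (1 + 25 * \<epsilon>) ^ s * ((1 + 25 * \<epsilon>) * A m a)"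
    using \<epsilon> by (intro mult_left_mono) auto
  thus ?case using Suc by (simp add: m_def mult_ac)
qed simp

lemma A_le_A_up:
  assumes a: "\<bar>drift k a\<bar> \<le> 4 * \<Lambda>" and s: "real s \<le> \<Lambda>"
  shows "A k a \<le> (1 + 50 * \<epsilon>) ^ s * A (k + s) a"
  using s
proof (induction s)
  case (Suc s)
  define m where "m = k + s"
  have b: "q\<^sup>2 * real k / 4 \<le> real k - real (min_blocks False a)" using window_bounds(1)[of a] a \<Lambda>_ge_1 by auto
  let ?u = "real m - real (min_blocks False a) + 1"
  have u: "q\<^sup>2 * real k / 4 \<le> ?u" using b by (simp add: m_def)
  have u0: "1 < ?u" using u \<Lambda>_small \<Lambda>_ge_1 by linarith
  have "(1 - q\<^sup>2) * real (Suc s) \<le> 1 * \<Lambda>" by (rule mult_mono) (use q2 Suc.prems in auto)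
  moreover have "drift m a - (1 - q\<^sup>2) = drift k a - (1 - q\<^sup>2) * real (Suc s)"
    unfolding m_def drift_shift by (simp add: algebra_simps)
  ultimately have l: "- (drift m a - (1 - q\<^sup>2)) \<le> 5 * \<Lambda>" using a by linarith
  have "- (drift m a - (1 - q\<^sup>2)) / ?u \<le> 5 * \<Lambda> / (q\<^sup>2 * real k / 4)"
  proof (rule order_trans)
    show "- (drift m a - (1 - q\<^sup>2)) / ?u \<le> 5 * \<Lambda> / ?u"
      using l u0 by (intro divide_right_mono) auto
    show "5 * \<Lambda> / ?u \<le> 5 * \<Lambda> / (q\<^sup>2 * real k / 4)"
      using u u0 k_pos q2 \<Lambda>_ge_1 by (intro divide_left_mono mult_pos_pos) auto
  qed
  also have "\<dots> = 20 * \<epsilon>" by (simp add: \<epsilon>_def)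
  finally have "- (20 * \<epsilon>) \<le> (drift m a - (1 - q\<^sup>2)) / ?u"
    unfolding minus_divide_left[symmetric] by linarith
  hence "1 - 20 * \<epsilon> \<le> \<rho> m a" using u0 by (subst \<rho>_drift) auto
  hence "(1 + 50 * \<epsilon>) * (1 - 20 * \<epsilon>) \<le> (1 + 50 * \<epsilon>) * \<rho> m a"
    using \<epsilon> by (intro mult_left_mono) auto
  \<comment> \<open>As \<open>\<epsilon>\<close> is at most 1/1000, the inverse of
    \<open>1 - 20 * \<epsilon>\<close> is at most \<open>1 + 50 * \<epsilon>\<close>.\<close>
  moreover have "1 \<le> (1 + 50 * \<epsilon>) * (1 - 20 * \<epsilon>)"
  proof -
    have "\<epsilon> * (1000 * \<epsilon>) \<le> \<epsilon> * 1" using \<epsilon> by (intro mult_left_mono) auto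
    thus ?thesis using \<epsilon> by (simp add: algebra_simps)
  qed
  ultimately have "1 \<le> (1 + 50 * \<epsilon>) * \<rho> m a" by linarith
  hence "1 * A m a \<le> (1 + 50 * \<epsilon>) * \<rho> m a * A m a" by (intro mult_right_mono) (auto simp: trace_prob_nonneg)
  moreover have "A (Suc m) a = A m a * \<rho> m a"
    by (rule A_Suc) (use u0 in linarith)
  ultimately have "A m a \<le> (1 + 50 * \<epsilon>) * A (Suc m) a" by (simp add: mult_ac)
  hence "(1 + 50 * \<epsilon>) ^ s * A (k + s) a \<le> (1 + 50 * \<epsilon>) ^ s * ((1 + 50 * \<epsilon>) * A (Suc m) a)"
    using \<epsilon> unfolding m_def by (intro mult_left_mono) auto
  thus ?case using Suc by (simp add: m_def mult_ac)
qed simp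

definition H_window :: "nat \<Rightarrow> bool list \<Rightarrow> real" where
  "H_window j z = (if j + 2 \<le> length z \<and> \<bar>drift k (take j z)\<bar> \<le> 3 * \<Lambda> \<and> \<bar>drift k (drop (j + 2) z)\<bar> \<le> 3 * \<Lambda>
     then H (take j z) (drop (j + 2) z) z else 0)"

lemma H_window_nonneg: "0 \<le> H_window j z"
  by (simp add: H_window_def H_nonneg)

text \<open>One block is taken from \<open>c\<close> at the cost of a factor 2, and two blocks are
  added to accommodate the two bits in front of it. This compares the share at \<open>j\<close> with
  the term at \<open>j\<close> for \<open>alt (2 * k + 1)\<close> split as
  \<open>alt k @ alt (Suc k)\<close>; those terms sum to \<open>A (2 * k + 1) z\<close>.\<close>

lemma H_window_le: "H_window j z \<le> C1 * (A k (take j z) * A (Suc k) (drop j z)) / A (2 * k + 1) z"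
proof (cases "j + 2 \<le> length z \<and> \<bar>drift k (take j z)\<bar> \<le> 3 * \<Lambda> \<and> \<bar>drift k (drop (j + 2) z)\<bar> \<le> 3 * \<Lambda>")
  case True
  hence "j + 2 \<le> length z" by simp
  then obtain a x y c where z: "z = a @ [x, y] @ c" "length a = j" by (rule split_at_pair)
  have c: "\<bar>drift k c\<bar> \<le> 3 * \<Lambda>" using True z by simp
  have km: "k = Suc (k - 1)" using k_pos by simp
  have "A k c \<le> (1 + 25 * \<epsilon>) ^ 1 * A (k - 1) c" using c \<Lambda>_ge_1 by (intro A_le_A_down) auto
  also have "\<dots> \<le> 2 * A (k - 1) c" using \<epsilon> by (intro mult_right_mono) (auto simp: trace_prob_nonneg)
  also have "2 * A (k - 1) c = C1 * ((1 - q)\<^sup>2 * q\<^sup>2 * A (k - 1) c)"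
    using q0 q1 by (simp add: C1_def)
  also have "\<dots> \<le> C1 * A (Suc (Suc (k - 1))) (x # y # c)"
    using C1_pos by (intro mult_left_mono A_insert_pair) auto
  finally have "A k c \<le> C1 * A (Suc k) (x # y # c)" using km by simp
  hence "A k a * A k c \<le> A k a * (C1 * A (Suc k) (x # y # c))"
    by (intro mult_left_mono) (auto simp: trace_prob_nonneg)
  hence "H a c z \<le> C1 * (A k a * A (Suc k) (x # y # c)) / A (2 * k + 1) z"
    unfolding H_def by (intro divide_right_mono) (auto simp: trace_prob_nonneg mult_ac)
  thus ?thesis using True z by (simp add: H_window_def)
next
  case False
  thus ?thesis using C1_pos by (auto simp: H_window_def trace_prob_nonneg)
qed

lemma sum_H_window_le:
  assumes "length z \<le> L"
  shows "(\<Sum>j\<le>L. H_window j z) \<le> C1"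
proof -
  have "(\<Sum>j\<le>L. H_window j z) = (\<Sum>j\<le>length z. H_window j z)"
    by (rule sum.mono_neutral_right) (use assms in \<open>auto simp: H_window_def\<close>)
  also have "\<dots> \<le> (\<Sum>j\<le>length z. C1 * (A k (take j z) * A (Suc k) (drop j z)) / A (2 * k + 1) z)"
    by (intro sum_mono H_window_le)
  also have "\<dots> = C1 * (\<Sum>j\<le>length z. A k (take j z) * A (Suc k) (drop j z)) / A (2 * k + 1) z"
    by (simp add: sum_distrib_left sum_divide_distrib)
  also have "(\<Sum>j\<le>length z. A k (take j z) * A (Suc k) (drop j z)) = A (2 * k + 1) z"
  proof -
    have "alt (2 * k + 1) = alt k @ alt (Suc k)"
      by (simp add: alt_add[symmetric] mult_2)
    thus ?thesis by (simp only: trace_prob_append)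
  qed
  also have "C1 * A (2 * k + 1) z / A (2 * k + 1) z \<le> C1"
    using C1_pos by simp
  finally show ?thesis .
qed

text \<open>The block boundary at which \<open>a\<close> ends is spread out: summing over all its positions costs no more
  than a constant times the whole law.\<close>

lemma sum_A_A_le:
  assumes s: "spliced a c z" and a: "\<bar>drift k a\<bar> \<le> 4 * \<Lambda>" and c: "\<bar>drift k c\<bar> \<le> 4 * \<Lambda>"
  shows "(\<Sum>t\<le>2 * k. A t a * A (2 * k - t) c) \<le> 8 / ((1 - q)\<^sup>2 * (q\<^sup>2)\<^sup>2) * A (2 * k + 1) z"
proof -
  define r where "r = min_blocks False a + min_blocks False c"
  define N where "N = length a + length c"
  have ba: "q\<^sup>2 * real k / 4 \<le> real k - real (min_blocks False a)" "q\<^sup>2 * real (length a) \<le> real k" "min_blocks False a \<le> k"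
    using window_bounds[of a] a \<Lambda>_ge_1 by auto
  have bc: "q\<^sup>2 * real k / 4 \<le> real k - real (min_blocks False c)" "q\<^sup>2 * real (length c) \<le> real k" "min_blocks False c \<le> k"
    using window_bounds[of c] c \<Lambda>_ge_1 by auto
  have r: "r \<le> 2 * k" using ba(3) bc(3) by (simp add: r_def)
  have U: "q\<^sup>2 * real k / 2 \<le> real (2 * k) - real r" using ba(1) bc(1) by (simp add: r_def)
  have big: "1000 \<le> q\<^sup>2 * real k" using \<Lambda>_ge_1 \<Lambda>_small by linarith
  have NN: "real (Suc (Suc N)) \<le> 4 * real k / q\<^sup>2"
  proof -
    have "q\<^sup>2 * real (Suc (Suc N)) = q\<^sup>2 * real (length a) + q\<^sup>2 * real (length c) + 2 * q\<^sup>2"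
      by (simp add: N_def algebra_simps)
    also have "\<dots> \<le> 4 * real k" using ba(2) bc(2) q2 big mult_right_mono[of "q\<^sup>2" 1 "real k"] by linarith
    finally show ?thesis using q2 by (simp add: field_simps)
  qed
  have "(\<Sum>t\<le>2 * k. A t a * A (2 * k - t) c) =
      \<theta> ^ N * q ^ (4 * k) * (\<Sum>t\<le>2 * k. embeddings t (min_blocks False a) (length a) * embeddings (2 * k - t) (min_blocks False c) (length c))"
  proof -
    have "A t a * A (2 * k - t) c = \<theta> ^ N * q ^ (4 * k) *
        (embeddings t (min_blocks False a) (length a) * embeddings (2 * k - t) (min_blocks False c) (length c))" if "t \<le> 2 * k" for t
    proof -
      have "q ^ (2 * t) * q ^ (2 * (2 * k - t)) = q ^ (4 * k)"
        using that by (simp add: power_add[symmetric] diff_mult_distrib2)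
      thus ?thesis by (simp add: trace_prob_alt N_def power_add mult_ac)
    qed
    thus ?thesis by (simp add: sum_distrib_left)
  qed
  also have "\<dots> = \<theta> ^ N * q ^ (4 * k) * embeddings (2 * k) r (Suc N)"
    by (simp add: embeddings_vandermonde r_def N_def)
  also have "\<dots> \<le> \<theta> ^ N * q ^ (4 * k) * (8 / (q\<^sup>2)\<^sup>2 * embeddings (2 * k + 1) (min_blocks False z) (N + 2))"
  proof (rule mult_left_mono)
    \<comment> \<open>Raising the rank and the number of gaps by one costs the ratio of gaps to
      spare blocks, which is bounded. One more block and one more rank give rank
      \<open>r + 2\<close>, the most that \<open>z\<close> can need.\<close>
    define v where "v = embeddings (2 * k) (Suc r) (Suc (Suc N))"
    have v0: "0 \<le> v" by (simp add: v_def embeddings_def)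
    have "embeddings (2 * k) r (Suc N) = v * real (Suc (Suc N)) / (real (2 * k) - real r)"
      using embeddings_Suc_rank[OF r, of "Suc N"] U big by (simp add: v_def field_simps)
    also have "\<dots> = v * (real (Suc (Suc N)) / (real (2 * k) - real r))" by simp
    also have "\<dots> \<le> v * ((4 * real k / q\<^sup>2) / (q\<^sup>2 * real k / 2))"
      by (intro mult_left_mono frac_le v0) (use NN U big in auto)
    also have "(4 * real k / q\<^sup>2) / (q\<^sup>2 * real k / 2) = 8 / (q\<^sup>2)\<^sup>2"
      using k_pos q2 by (simp add: field_simps power2_eq_square)
    also have "v = embeddings (2 * k + 1) (Suc (Suc r)) (N + 2)" by (simp add: v_def)
    also have "\<dots> \<le> embeddings (2 * k + 1) (min_blocks False z) (N + 2)"
      using s by (intro embeddings_antimono) (simp add: spliced_def r_def)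
    finally show "embeddings (2 * k) r (Suc N) \<le> 8 / (q\<^sup>2)\<^sup>2 * embeddings (2 * k + 1) (min_blocks False z) (N + 2)"
      by (simp add: mult.commute divide_right_mono)
  qed (use \<theta>_pos q0 in auto)
  also have "\<dots> = 8 / ((1 - q)\<^sup>2 * (q\<^sup>2)\<^sup>2) * A (2 * k + 1) z"
  proof -
    have e1: "length z = N + 2" using s by (simp add: spliced_def N_def)
    have e2: "q ^ (2 * (2 * k + 1)) = q ^ (4 * k) * q\<^sup>2" by (simp add: power_add[symmetric])
    have e3: "\<theta> ^ (N + 2) * q\<^sup>2 = \<theta> ^ N * (1 - q)\<^sup>2"
      by (simp add: q_\<theta>[symmetric] power_add power_mult_distrib power2_eq_square)
    have "A (2 * k + 1) z = \<theta> ^ (N + 2) * (q ^ (4 * k) * q\<^sup>2) * embeddings (2 * k + 1) (min_blocks False z) (N + 2)"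
      by (simp only: trace_prob_alt e1 e2)
    also have "\<dots> = (\<theta> ^ (N + 2) * q\<^sup>2) * q ^ (4 * k) * embeddings (2 * k + 1) (min_blocks False z) (N + 2)"
      by (simp only: mult_ac)
    finally have "A (2 * k + 1) z = \<theta> ^ N * (1 - q)\<^sup>2 * q ^ (4 * k) * embeddings (2 * k + 1) (min_blocks False z) (N + 2)"
      by (simp only: e3)
    thus ?thesis using q1 by simp
  qed
  finally show ?thesis .
qed

text \<open>Moving the boundary by \<open>t \<le> 1 / \<epsilon>\<close> blocks changes the product by a bounded factor only, so each
  position carries at most a fraction of order \<open>\<epsilon>\<close> of the mass.\<close>

lemma H_window_le_\<epsilon>: "H_window j z \<le> C2 * \<epsilon>"
proof (cases "j + 2 \<le> length z \<and> \<bar>drift k (take j z)\<bar> \<le> 3 * \<Lambda> \<and> \<bar>drift k (drop (j + 2) z)\<bar> \<le> 3 * \<Lambda>")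
  case True
  define a where "a = take j z"
  define c where "c = drop (j + 2) z"
  have s: "spliced a c z" unfolding a_def c_def using True by (intro spliced_take_drop) auto
  have ac: "\<bar>drift k a\<bar> \<le> 4 * \<Lambda>" "\<bar>drift k c\<bar> \<le> 4 * \<Lambda>" using True \<Lambda>_ge_1 by (auto simp: a_def c_def)
  \<comment> \<open>\<open>J + 1\<close> is at least 1 / (q^2 \<open>\<epsilon>\<close>), so
    averaging over this many boundaries gains a factor of order \<open>\<epsilon>\<close>. As k is
    at most \<open>\<Lambda>^2\<close>, \<open>J\<close> does not exceed \<open>\<Lambda>\<close>,
    as the comparison of laws requires.\<close>
  define J where "J = nat \<lfloor>real k / \<Lambda>\<rfloor>"
  have kL: "0 \<le> real k / \<Lambda>" using \<Lambda>_ge_1 by simp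
  have J: "real J \<le> real k / \<Lambda>" "real k / \<Lambda> \<le> real J + 1"
    using kL unfolding J_def by linarith+
  have "real k / \<Lambda> \<le> \<Lambda>" using k_le_\<Lambda> \<Lambda>_ge_1 by (simp add: field_simps power2_eq_square)
  hence JL: "real J \<le> \<Lambda>" using J by linarith
  have \<epsilon>J: "\<epsilon> * real J \<le> 1 / q\<^sup>2"
  proof -
    have "\<epsilon> * real J \<le> \<epsilon> * (real k / \<Lambda>)" using J \<epsilon> by (intro mult_left_mono) auto
    also have "\<dots> = 1 / q\<^sup>2" using k_pos \<Lambda>_ge_1 by (simp add: \<epsilon>_def)
    finally show ?thesis .
  qed
  have pw: "(1 + m * \<epsilon>) ^ t \<le> exp (m / q\<^sup>2)" if "t \<le> J" "0 \<le> m" for t m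
  proof -
    have "(1 + m * \<epsilon>) ^ t \<le> (1 + m * \<epsilon>) ^ J" using that \<epsilon> by (intro power_increasing) auto
    also have "\<dots> \<le> exp (m * \<epsilon>) ^ J" using that \<epsilon> by (intro power_mono exp_ge_add_one_self) auto
    also have "\<dots> = exp (m * (\<epsilon> * real J))" by (simp add: exp_of_nat_mult[symmetric] mult_ac)
    also have "\<dots> \<le> exp (m * (1 / q\<^sup>2))" using \<epsilon>J that by (subst exp_le_cancel_iff) (intro mult_left_mono)
    finally show ?thesis by simp
  qed
  let ?E = "exp (75 / q\<^sup>2)"
  have Jk: "J \<le> k"
  proof -
    have "0 \<le> q\<^sup>2 * real k" "q\<^sup>2 * real k \<le> real k" using q2 k_pos by auto
    hence "real J \<le> real k" using JL \<Lambda>_small by linarith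
    thus ?thesis by simp
  qed
  have t: "A k a * A k c \<le> ?E * (A (k - t) a * A (k + t) c)" if "t \<le> J" for t
  proof -
    have tL: "real t \<le> \<Lambda>" using that JL by linarith
    have "A k a \<le> (1 + 25 * \<epsilon>) ^ t * A (k - t) a" using A_le_A_down[OF ac(1) tL] .
    also have "\<dots> \<le> exp (25 / q\<^sup>2) * A (k - t) a" using pw[OF that, of 25] by (intro mult_right_mono) (auto simp: trace_prob_nonneg)
    finally have 1: "A k a \<le> exp (25 / q\<^sup>2) * A (k - t) a" .
    have "A k c \<le> (1 + 50 * \<epsilon>) ^ t * A (k + t) c" using A_le_A_up[OF ac(2) tL] .
    also have "\<dots> \<le> exp (50 / q\<^sup>2) * A (k + t) c" using pw[OF that, of 50] by (intro mult_right_mono) (auto simp: trace_prob_nonneg)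
    finally have 2: "A k c \<le> exp (50 / q\<^sup>2) * A (k + t) c" .
    have "A k a * A k c \<le> (exp (25 / q\<^sup>2) * A (k - t) a) * (exp (50 / q\<^sup>2) * A (k + t) c)"
      using 1 2 by (intro mult_mono) (auto simp: trace_prob_nonneg)
    also have "\<dots> = (exp (25 / q\<^sup>2) * exp (50 / q\<^sup>2)) * (A (k - t) a * A (k + t) c)" by (simp add: mult_ac)
    also have "exp (25 / q\<^sup>2) * exp (50 / q\<^sup>2) = ?E" by (simp add: exp_add[symmetric] add_divide_distrib[symmetric])
    finally show ?thesis .
  qed
  have "(real J + 1) * (A k a * A k c) = (\<Sum>t\<le>J. A k a * A k c)" by simp
  also have "\<dots> \<le> (\<Sum>t\<le>J. ?E * (A (k - t) a * A (k + t) c))" using t by (intro sum_mono) auto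
  also have "\<dots> = ?E * (\<Sum>t\<le>J. A (k - t) a * A (2 * k - (k - t)) c)"
    unfolding sum_distrib_left using Jk by (intro sum.cong) (auto intro!: arg_cong[of _ _ "\<lambda>m. A m c"])
  also have "(\<Sum>t\<le>J. A (k - t) a * A (2 * k - (k - t)) c) = (\<Sum>m\<in>(\<lambda>t. k - t) ` {..J}. A m a * A (2 * k - m) c)"
    using Jk by (subst sum.reindex) (auto simp: inj_on_def)
  also have "?E * \<dots> \<le> ?E * (\<Sum>m\<le>2 * k. A m a * A (2 * k - m) c)"
    by (intro mult_left_mono sum_mono2) (auto simp: trace_prob_nonneg)
  also have "\<dots> \<le> ?E * (8 / ((1 - q)\<^sup>2 * (q\<^sup>2)\<^sup>2) * A (2 * k + 1) z)"
    by (intro mult_left_mono sum_A_A_le s ac) auto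
  also have "\<dots> = C2 / q\<^sup>2 * A (2 * k + 1) z"
    using q2 by (simp add: C2_def power2_eq_square)
  finally have *: "(real J + 1) * (A k a * A k c) \<le> C2 / q\<^sup>2 * A (2 * k + 1) z" .
  have Apos: "0 < A (2 * k + 1) z" using window_splice(1)[OF s ac] by (rule A_pos)
  have "real k / \<Lambda> * (A k a * A k c) \<le> (real J + 1) * (A k a * A k c)"
    using J by (intro mult_right_mono) (auto simp: trace_prob_nonneg)
  with * have "real k / \<Lambda> * (A k a * A k c) \<le> C2 / q\<^sup>2 * A (2 * k + 1) z" by linarith
  hence "real k / \<Lambda> * (A k a * A k c) / A (2 * k + 1) z \<le> C2 / q\<^sup>2 * A (2 * k + 1) z / A (2 * k + 1) z"
    using Apos by (intro divide_right_mono) auto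
  hence "real k / \<Lambda> * H a c z \<le> C2 / q\<^sup>2" using Apos by (simp add: H_def)
  hence "H a c z \<le> C2 * \<epsilon>" using k_pos \<Lambda>_ge_1 q2 by (simp add: \<epsilon>_def field_simps)
  thus ?thesis using True by (simp add: H_window_def a_def c_def)
next
  case False
  thus ?thesis using C2_pos \<epsilon> by (auto simp: H_window_def)
qed

end

section \<open>The Hellinger distance of the two defective strings\<close>

text \<open>If \<open>b\<close> dominates, bound the square by \<open>\<bar>P - Q\<bar>\<close>,
  which is at most twice \<open>\<bar>b\<bar>\<close>. If \<open>g\<close> dominates, divide the
  square of \<open>P - Q\<close> by that of \<open>sqrt P + sqrt Q\<close>, which is at least
  \<open>2 * c * R\<close>.\<close>

lemma sqrt_diff_sq_le:
  fixes P Q R g b c :: real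
  assumes D: "P - Q = g + b" and PQ: "0 \<le> P" "0 \<le> Q"
    and c: "0 < c" and R: "0 \<le> R" "c * R \<le> P" "c * R \<le> Q"
    and g: "g = R * x"
  shows "(sqrt P - sqrt Q)\<^sup>2 \<le> 2 * \<bar>b\<bar> + 2 / c * (R * x\<^sup>2)"
proof -
  have le1: "(sqrt P - sqrt Q)\<^sup>2 \<le> \<bar>P - Q\<bar>"
  proof -
    have "(sqrt P - sqrt Q)\<^sup>2 = \<bar>sqrt P - sqrt Q\<bar> * \<bar>sqrt P - sqrt Q\<bar>" by (simp add: power2_eq_square)
    also have "\<dots> \<le> \<bar>sqrt P - sqrt Q\<bar> * \<bar>sqrt P + sqrt Q\<bar>"
      using PQ by (intro mult_left_mono) (auto simp: abs_le_iff)
    also have "\<dots> = \<bar>P - Q\<bar>"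
      using PQ by (subst abs_mult[symmetric]) (simp add: algebra_simps)
    finally show ?thesis .
  qed
  have nn: "0 \<le> 2 / c * (R * x\<^sup>2)" using c R by simp
  show ?thesis
  proof (cases "\<bar>g\<bar> \<le> \<bar>b\<bar>")
    case True
    thus ?thesis using le1 D nn by linarith
  next
    case False
    hence R0: "0 < R" using g R by (cases "R = 0") auto
    have sum2: "2 * (c * R) \<le> (sqrt P + sqrt Q)\<^sup>2"
    proof -
      have "0 \<le> sqrt P * sqrt Q" using PQ by simp
      moreover have "(sqrt P + sqrt Q)\<^sup>2 = P + Q + 2 * (sqrt P * sqrt Q)"
        using PQ by (simp add: power2_sum)
      ultimately show ?thesis using R by linarith
    qed
    have pos: "0 < 2 * (c * R)" using c R0 by simp
    have "(sqrt P - sqrt Q)\<^sup>2 * (sqrt P + sqrt Q)\<^sup>2 = (P - Q)\<^sup>2"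
      using PQ by (simp add: power_mult_distrib[symmetric] algebra_simps)
    also have "\<dots> \<le> (2 * g)\<^sup>2"
      using False D by (subst abs_le_square_iff[symmetric]) linarith
    also have "\<dots> = 4 * R\<^sup>2 * x\<^sup>2" by (simp add: g power_mult_distrib)
    finally have "(sqrt P - sqrt Q)\<^sup>2 * (sqrt P + sqrt Q)\<^sup>2 \<le> 4 * R\<^sup>2 * x\<^sup>2" .
    moreover have "(sqrt P - sqrt Q)\<^sup>2 * (2 * (c * R)) \<le> (sqrt P - sqrt Q)\<^sup>2 * (sqrt P + sqrt Q)\<^sup>2"
      using sum2 by (intro mult_left_mono) auto
    ultimately have "(sqrt P - sqrt Q)\<^sup>2 * (2 * (c * R)) \<le> 4 * R\<^sup>2 * x\<^sup>2" by linarith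
    hence "(sqrt P - sqrt Q)\<^sup>2 \<le> 4 * R\<^sup>2 * x\<^sup>2 / (2 * (c * R))"
      by (subst pos_le_divide_eq[OF pos])
    also have "\<dots> = 2 / c * (R * x\<^sup>2)" using c R0 by (simp add: power2_eq_square)
    finally show ?thesis by linarith
  qed
qed

lemma nth_swap_adj: "m \<noteq> j \<Longrightarrow> m \<noteq> Suc j \<Longrightarrow> swap_adj j z ! m = z ! m"
proof (cases "j + 2 \<le> length z")
  case True
  assume m: "m \<noteq> j" "m \<noteq> Suc j"
  from True obtain a x y c where z: "z = a @ [x, y] @ c" "length a = j" by (rule split_at_pair)
  have "(a @ [y, x] @ c) ! m = (a @ [x, y] @ c) ! m"
  proof (cases "m < j")
    case False
    then obtain t where "m = j + Suc (Suc t)"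
      using m by (intro that[of "m - (j + 2)"]) simp
    thus ?thesis using z(2) by (simp add: nth_append)
  qed (use z(2) in \<open>simp add: nth_append\<close>)
  thus ?thesis unfolding z(1) swap_adj_split[OF z(2)] .
qed (simp add: swap_adj_def)

section \<open>The second moment of the difference\<close>

context window
begin

definition X :: "nat \<Rightarrow> bool list \<Rightarrow> real" where
  "X j z = (if j + 2 \<le> length z then (1 - q)\<^sup>2 * sgnbit z j * F (take j z) (drop (j + 2) z) z else 0)"

lemma F_bound_good:
  "\<bar>F a c z\<bar> \<le> (if \<bar>drift k a\<bar> \<le> 3 * \<Lambda> \<and> \<bar>drift k c\<bar> \<le> 3 * \<Lambda> then 40 * \<epsilon> * H a c z else 0)"
proof (cases "\<bar>drift k a\<bar> \<le> 3 * \<Lambda> \<and> \<bar>drift k c\<bar> \<le> 3 * \<Lambda>")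
  case False
  hence "cut a = 0 \<or> cut c = 0" using cut_eq_0[of a] cut_eq_0[of c] \<Lambda>_ge_1 by linarith
  thus ?thesis using False by (auto simp: F_def)
qed (use F_bound in auto)

lemma coeff_le_1: "\<bar>(1 - q)\<^sup>2 * sgnbit z j\<bar> \<le> 1"
  unfolding abs_mult using q0 q1 abs_sgnbit[of z j] by (intro mult_le_one) (auto simp: power_le_one)

lemma X_bound: "\<bar>X j z\<bar> \<le> 40 * \<epsilon> * H_window j z"
proof (cases "j + 2 \<le> length z")
  case True
  have "\<bar>X j z\<bar> \<le> 1 * \<bar>F (take j z) (drop (j + 2) z) z\<bar>"
    using True mult_right_mono[OF coeff_le_1[of z j], of "\<bar>F (take j z) (drop (j + 2) z) z\<bar>"]
    by (simp add: X_def abs_mult)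
  also have "\<dots> \<le> 40 * \<epsilon> * H_window j z"
    using F_bound_good[of "take j z" "drop (j + 2) z" z] True by (auto simp: H_window_def)
  finally show ?thesis .
qed (simp add: X_def H_window_def)

text \<open>A distant exchange alters only one of the two outer parts and keeps a bit between the
  pair and the cut. If it lies after \<open>j\<close>, the antisymmetry of \<open>F\<close> reduces
  it to a change of the first argument.\<close>

lemma X_swap_adj:
  assumes far: "i + 3 \<le> j \<or> j + 3 \<le> i"
  shows "\<bar>X j z - X j (swap_adj i z)\<bar> \<le> 4200 * \<epsilon>\<^sup>2 * H_window j z"
proof (cases "j + 2 \<le> length z \<and> i + 2 \<le> length z")
  case False
  have "0 \<le> 4200 * \<epsilon>\<^sup>2 * H_window j z" by (simp add: H_window_nonneg)
  thus ?thesis using False by (auto simp: X_def swap_adj_def)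
next
  case True
  define a c where "a = take j z" and "c = drop (j + 2) z"
  define a' c' where "a' = take j (swap_adj i z)" and "c' = drop (j + 2) (swap_adj i z)"
  have s: "spliced a c z" unfolding a_def c_def using True by (intro spliced_take_drop) auto
  have sg: "sgnbit (swap_adj i z) j = sgnbit z j"
  proof -
    have "swap_adj i z ! j = z ! j" "swap_adj i z ! Suc j = z ! Suc j"
      by (rule nth_swap_adj; use far in linarith)+
    thus ?thesis by (simp add: sgnbit_def)
  qed
  have F: "\<bar>F a c z - F a' c' (swap_adj i z)\<bar> \<le> 4200 * \<epsilon>\<^sup>2 * H_window j z"
  proof (cases "i + 3 \<le> j")
    case less: True
    have c': "c' = c" unfolding c_def c'_def
      using swap_adj_before(1)[of i "j + 2" z] less True by simp
    obtain d where "\<bar>d\<bar> \<le> 1" "int (min_blocks False (swap_adj i z)) = int (min_blocks False z) + d"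
      "int (min_blocks False a') = int (min_blocks False a) + d"
      using swap_adj_before(2)[of i j z False] less True unfolding a_def a'_def by auto
    hence "\<bar>F a c z - F a' c (swap_adj i z)\<bar> \<le>
        (if \<bar>drift k a\<bar> \<le> 3 * \<Lambda> \<and> \<bar>drift k c\<bar> \<le> 3 * \<Lambda> then 4200 * \<epsilon>\<^sup>2 * H a c z else 0)"
      by (intro F_shift s) (auto simp: a_def a'_def)
    thus ?thesis using True unfolding c' by (auto simp: H_window_def a_def c_def)
  next
    case False
    hence gr: "j + 3 \<le> i" using far by auto
    have a': "a' = a" unfolding a_def a'_def
      using swap_adj_after(1)[of j i z] gr True by simp
    obtain d where "\<bar>d\<bar> \<le> 1" "int (min_blocks False (swap_adj i z)) = int (min_blocks False z) + d"
      "int (min_blocks False c') = int (min_blocks False c) + d"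
      using swap_adj_after(2)[of "j + 2" i z False False] gr True unfolding c_def c'_def by auto
    hence "\<bar>F c a z - F c' a (swap_adj i z)\<bar> \<le>
        (if \<bar>drift k c\<bar> \<le> 3 * \<Lambda> \<and> \<bar>drift k a\<bar> \<le> 3 * \<Lambda> then 4200 * \<epsilon>\<^sup>2 * H c a z else 0)"
      using s by (intro F_shift) (auto simp: c_def c'_def spliced_commute)
    moreover have "F a c z - F a c' (swap_adj i z) = - (F c a z - F c' a (swap_adj i z))"
      using F_commute[of a c z] F_commute[of a c' "swap_adj i z"] by simp
    ultimately have "\<bar>F a c z - F a c' (swap_adj i z)\<bar> \<le>
        (if \<bar>drift k c\<bar> \<le> 3 * \<Lambda> \<and> \<bar>drift k a\<bar> \<le> 3 * \<Lambda> then 4200 * \<epsilon>\<^sup>2 * H a c z else 0)"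
      unfolding H_commute[of c a z] by (simp only: abs_minus_cancel)
    thus ?thesis using True unfolding a' by (auto simp: H_window_def a_def c_def)
  qed
  have "\<bar>X j z - X j (swap_adj i z)\<bar> = \<bar>(1 - q)\<^sup>2 * sgnbit z j\<bar> * \<bar>F a c z - F a' c' (swap_adj i z)\<bar>"
    using True by (simp add: X_def sg a_def c_def a'_def c'_def abs_mult right_diff_distrib[symmetric] mult.assoc)
  also have "\<dots> \<le> 1 * (4200 * \<epsilon>\<^sup>2 * H_window j z)"
    using F coeff_le_1[of z j] by (intro mult_mono) auto
  finally show ?thesis by simp
qed

definition Y_cut :: "nat \<Rightarrow> bool list \<Rightarrow> real" where
  "Y_cut j z = cut (take j z) * cut (drop (j + 2) z) * Y k j z"

text \<open>Where the cutoffs do not vanish, \<open>z\<close> embeds into \<open>2 * k + 1\<close>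
  blocks, so the denominator in \<open>F\<close> is positive and cancels.\<close>

lemma Y_cut_eq_X: "Y_cut j z = A (2 * k + 1) z * X j z"
proof (cases "j + 2 \<le> length z \<and> cut (take j z) \<noteq> 0 \<and> cut (drop (j + 2) z) \<noteq> 0")
  case True
  hence s: "spliced (take j z) (drop (j + 2) z) z" by (intro spliced_take_drop) auto
  have "\<bar>drift k (take j z)\<bar> \<le> 4 * \<Lambda>" "\<bar>drift k (drop (j + 2) z)\<bar> \<le> 4 * \<Lambda>"
    using cut_eq_0[of "take j z"] cut_eq_0[of "drop (j + 2) z"] True \<Lambda>_ge_1 by linarith+
  from A_pos[OF window_splice(1)[OF s this]] show ?thesis
    using True by (simp add: Y_cut_def X_def Y_def F_def)
next
  case False
  thus ?thesis by (auto simp: Y_cut_def X_def Y_def F_def)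
qed

lemma Y_cut_swap_adj: "Y_cut j (swap_adj j z) = - Y_cut j z"
  unfolding Y_cut_def Y_swap_adj take_swap_adj drop_swap_adj by simp

lemma Y_cut_bound: "\<bar>Y_cut j z\<bar> \<le> A (2 * k + 1) z * (40 * \<epsilon> * H_window j z)"
  unfolding Y_cut_eq_X abs_mult using X_bound[of j z]
  by (simp add: trace_prob_nonneg mult_left_mono)

text \<open>Exchanging bits \<open>i\<close> and \<open>i + 1\<close> negates \<open>Y_cut i\<close> but hardly affects \<open>X j\<close>, so the sum equals half of
  the sum of \<open>Y_cut i\<close> times a small increment of \<open>X j\<close>.\<close>

lemma far_pair_sum_le:
  assumes far: "i + 3 \<le> j \<or> j + 3 \<le> i"
  shows "(\<Sum>z\<in>lists_upto L. Y_cut i z * X j z) \<le>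
    (\<Sum>z\<in>lists_upto L. A (2 * k + 1) z * (84000 * \<epsilon> ^ 3 * (H_window i z * H_window j z)))"
proof -
  let ?Z = "lists_upto L"
  have "(\<Sum>z\<in>?Z. Y_cut i z * X j z) = (\<Sum>z\<in>?Z. Y_cut i (swap_adj i z) * X j (swap_adj i z))"
    by (rule sum.reindex_bij_betw[OF bij_swap_adj, symmetric])
  also have "\<dots> = - (\<Sum>z\<in>?Z. Y_cut i z * X j (swap_adj i z))"
    by (simp add: Y_cut_swap_adj sum_negf)
  finally have "2 * (\<Sum>z\<in>?Z. Y_cut i z * X j z) = (\<Sum>z\<in>?Z. Y_cut i z * (X j z - X j (swap_adj i z)))"
    by (simp add: right_diff_distrib sum_subtractf)
  also have "\<dots> \<le> (\<Sum>z\<in>?Z. (A (2 * k + 1) z * (40 * \<epsilon> * H_window i z)) * (4200 * \<epsilon>\<^sup>2 * H_window j z))"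
  proof (rule sum_mono)
    fix z
    have "Y_cut i z * (X j z - X j (swap_adj i z)) \<le> \<bar>Y_cut i z\<bar> * \<bar>X j z - X j (swap_adj i z)\<bar>"
      by (simp add: abs_mult[symmetric])
    also have "\<dots> \<le> (A (2 * k + 1) z * (40 * \<epsilon> * H_window i z)) * (4200 * \<epsilon>\<^sup>2 * H_window j z)"
      using Y_cut_bound[of i z] X_swap_adj[OF far, of z] \<epsilon> by (intro mult_mono) (auto simp: trace_prob_nonneg H_window_nonneg)
    finally show "Y_cut i z * (X j z - X j (swap_adj i z)) \<le> (A (2 * k + 1) z * (40 * \<epsilon> * H_window i z)) * (4200 * \<epsilon>\<^sup>2 * H_window j z)" .
  qed
  also have "\<dots> = 2 * (\<Sum>z\<in>?Z. A (2 * k + 1) z * (84000 * \<epsilon> ^ 3 * (H_window i z * H_window j z)))"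
    by (simp add: sum_distrib_left power3_eq_cube power2_eq_square mult_ac)
  finally show ?thesis by simp
qed

text \<open>Each \<open>i\<close> has at most five near \<open>j\<close>. The bound
  \<open>C2 * \<epsilon>\<close> for a single share is used for \<open>j\<close>, and the bound
  \<open>C1\<close> for the total share in the sum over \<open>i\<close>.\<close>

lemma near_pair_sum_le:
  assumes "length z \<le> L"
  shows "(\<Sum>i\<le>L. \<Sum>j\<in>{j\<in>{..L}. \<not> (i + 3 \<le> j \<or> j + 3 \<le> i)}. Y_cut i z * X j z)
    \<le> A (2 * k + 1) z * (8000 * C1 * C2 * \<epsilon> ^ 3)"
proof -
  have "(\<Sum>i\<le>L. \<Sum>j\<in>{j\<in>{..L}. \<not> (i + 3 \<le> j \<or> j + 3 \<le> i)}. Y_cut i z * X j z)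
      \<le> (\<Sum>i\<le>L. A (2 * k + 1) z * (8000 * C2 * \<epsilon> ^ 3) * H_window i z)"
  proof (rule sum_mono)
    fix i
    let ?N = "{j\<in>{..L}. \<not> (i + 3 \<le> j \<or> j + 3 \<le> i)}"
    have "?N \<subseteq> {i - 2..i + 2}" by auto
    hence "card ?N \<le> card {i - 2..i + 2}" by (intro card_mono) auto
    hence card: "real (card ?N) \<le> 5" by simp
    have "(\<Sum>j\<in>?N. Y_cut i z * X j z) \<le> (\<Sum>j\<in>?N. (A (2 * k + 1) z * (40 * \<epsilon> * H_window i z)) * (40 * \<epsilon> * (C2 * \<epsilon>)))"
    proof (rule sum_mono)
      fix j
      have "\<bar>X j z\<bar> \<le> 40 * \<epsilon> * (C2 * \<epsilon>)"
        using X_bound[of j z] mult_left_mono[OF H_window_le_\<epsilon>[of j z], of "40 * \<epsilon>"] \<epsilon> by linarith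
      hence "\<bar>Y_cut i z\<bar> * \<bar>X j z\<bar> \<le> (A (2 * k + 1) z * (40 * \<epsilon> * H_window i z)) * (40 * \<epsilon> * (C2 * \<epsilon>))"
        using Y_cut_bound[of i z] \<epsilon> by (intro mult_mono) (auto simp: trace_prob_nonneg H_window_nonneg)
      moreover have "Y_cut i z * X j z \<le> \<bar>Y_cut i z\<bar> * \<bar>X j z\<bar>"
        using abs_ge_self[of "Y_cut i z * X j z"] unfolding abs_mult .
      ultimately show "Y_cut i z * X j z \<le> (A (2 * k + 1) z * (40 * \<epsilon> * H_window i z)) * (40 * \<epsilon> * (C2 * \<epsilon>))"
        by (rule order_trans[rotated])
    qed
    also have "\<dots> = real (card ?N) * ((A (2 * k + 1) z * (40 * \<epsilon> * H_window i z)) * (40 * \<epsilon> * (C2 * \<epsilon>)))" by simp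
    also have "\<dots> \<le> 5 * ((A (2 * k + 1) z * (40 * \<epsilon> * H_window i z)) * (40 * \<epsilon> * (C2 * \<epsilon>)))"
      using card \<epsilon> C2_pos by (intro mult_right_mono) (auto simp: trace_prob_nonneg H_window_nonneg)
    also have "\<dots> = A (2 * k + 1) z * (8000 * C2 * \<epsilon> ^ 3) * H_window i z" by (simp add: power3_eq_cube)
    finally show "(\<Sum>j\<in>?N. Y_cut i z * X j z) \<le> A (2 * k + 1) z * (8000 * C2 * \<epsilon> ^ 3) * H_window i z" .
  qed
  also have "\<dots> = A (2 * k + 1) z * (8000 * C2 * \<epsilon> ^ 3) * (\<Sum>i\<le>L. H_window i z)" by (simp only: sum_distrib_left)
  also have "\<dots> \<le> A (2 * k + 1) z * (8000 * C2 * \<epsilon> ^ 3) * C1"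
    using sum_H_window_le[OF assms] \<epsilon> C2_pos by (intro mult_left_mono) (auto simp: trace_prob_nonneg)
  finally show ?thesis by (simp add: mult_ac)
qed

lemma second_moment_le:
  "(\<Sum>z\<in>lists_upto L. A (2 * k + 1) z * (\<Sum>j\<le>L. X j z)\<^sup>2) \<le> C3 * \<epsilon> ^ 3"
proof -
  let ?Z = "lists_upto L"
  let ?far = "\<lambda>i j :: nat. i + 3 \<le> j \<or> j + 3 \<le> i"
  have "(\<Sum>z\<in>?Z. A (2 * k + 1) z * (\<Sum>j\<le>L. X j z)\<^sup>2) = (\<Sum>z\<in>?Z. \<Sum>i\<le>L. \<Sum>j\<le>L. Y_cut i z * X j z)"
  proof (rule sum.cong[OF refl])
    fix z
    have "(\<Sum>i\<le>L. \<Sum>j\<le>L. Y_cut i z * X j z) = (\<Sum>i\<le>L. Y_cut i z) * (\<Sum>j\<le>L. X j z)"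
      by (rule sum_product[symmetric])
    also have "(\<Sum>i\<le>L. Y_cut i z) = A (2 * k + 1) z * (\<Sum>j\<le>L. X j z)"
      by (simp only: sum_distrib_left Y_cut_eq_X)
    finally show "A (2 * k + 1) z * (\<Sum>j\<le>L. X j z)\<^sup>2 = (\<Sum>i\<le>L. \<Sum>j\<le>L. Y_cut i z * X j z)"
      by (simp only: power2_eq_square mult.assoc)
  qed
  also have "\<dots> = (\<Sum>z\<in>?Z. \<Sum>i\<le>L. (\<Sum>j\<in>{j\<in>{..L}. \<not> ?far i j}. Y_cut i z * X j z) + (\<Sum>j\<in>{j\<in>{..L}. ?far i j}. Y_cut i z * X j z))"
  proof (intro sum.cong refl)
    fix z i
    have "{..L} = {j\<in>{..L}. \<not> ?far i j} \<union> {j\<in>{..L}. ?far i j}" by auto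
    moreover have "{j\<in>{..L}. \<not> ?far i j} \<inter> {j\<in>{..L}. ?far i j} = {}" by auto
    ultimately show "(\<Sum>j\<le>L. Y_cut i z * X j z) = (\<Sum>j\<in>{j\<in>{..L}. \<not> ?far i j}. Y_cut i z * X j z) + (\<Sum>j\<in>{j\<in>{..L}. ?far i j}. Y_cut i z * X j z)"
      by (metis (no_types, lifting) finite_Un finite_atMost sum.union_disjoint)
  qed
  also have "\<dots> = (\<Sum>z\<in>?Z. \<Sum>i\<le>L. \<Sum>j\<in>{j\<in>{..L}. \<not> ?far i j}. Y_cut i z * X j z) +
      (\<Sum>z\<in>?Z. \<Sum>i\<le>L. \<Sum>j\<in>{j\<in>{..L}. ?far i j}. Y_cut i z * X j z)"
    by (simp only: sum.distrib)
  finally have split: "(\<Sum>z\<in>?Z. A (2 * k + 1) z * (\<Sum>j\<le>L. X j z)\<^sup>2) =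
      (\<Sum>z\<in>?Z. \<Sum>i\<le>L. \<Sum>j\<in>{j\<in>{..L}. \<not> ?far i j}. Y_cut i z * X j z) +
      (\<Sum>z\<in>?Z. \<Sum>i\<le>L. \<Sum>j\<in>{j\<in>{..L}. ?far i j}. Y_cut i z * X j z)" .
  have near: "(\<Sum>z\<in>?Z. \<Sum>i\<le>L. \<Sum>j\<in>{j\<in>{..L}. \<not> ?far i j}. Y_cut i z * X j z) \<le>
      (\<Sum>z\<in>?Z. A (2 * k + 1) z) * (8000 * C1 * C2 * \<epsilon> ^ 3)"
    unfolding sum_distrib_right by (rule sum_mono) (rule near_pair_sum_le, simp)
  have "(\<Sum>z\<in>?Z. \<Sum>i\<le>L. \<Sum>j\<in>{j\<in>{..L}. ?far i j}. Y_cut i z * X j z)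
      = (\<Sum>i\<le>L. \<Sum>j\<in>{j\<in>{..L}. ?far i j}. \<Sum>z\<in>?Z. Y_cut i z * X j z)"
    by (subst sum.swap, rule sum.cong, rule refl, rule sum.swap)
  also have "\<dots> \<le> (\<Sum>i\<le>L. \<Sum>j\<in>{j\<in>{..L}. ?far i j}. \<Sum>z\<in>?Z. A (2 * k + 1) z * (84000 * \<epsilon> ^ 3 * (H_window i z * H_window j z)))"
    by (intro sum_mono far_pair_sum_le) auto
  also have "\<dots> \<le> (\<Sum>i\<le>L. \<Sum>j\<le>L. \<Sum>z\<in>?Z. A (2 * k + 1) z * (84000 * \<epsilon> ^ 3 * (H_window i z * H_window j z)))"
    using \<epsilon> by (intro sum_mono sum_mono2) (auto intro!: sum_nonneg simp: trace_prob_nonneg H_window_nonneg)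
  also have "\<dots> = (\<Sum>i\<le>L. \<Sum>z\<in>?Z. \<Sum>j\<le>L. A (2 * k + 1) z * (84000 * \<epsilon> ^ 3 * (H_window i z * H_window j z)))"
    by (intro sum.cong refl sum.swap)
  also have "\<dots> = (\<Sum>z\<in>?Z. \<Sum>i\<le>L. \<Sum>j\<le>L. A (2 * k + 1) z * (84000 * \<epsilon> ^ 3 * (H_window i z * H_window j z)))"
    by (rule sum.swap)
  also have "\<dots> = (\<Sum>z\<in>?Z. A (2 * k + 1) z * (84000 * \<epsilon> ^ 3 * ((\<Sum>i\<le>L. H_window i z) * (\<Sum>j\<le>L. H_window j z))))"
    by (intro sum.cong refl) (simp only: sum_product, simp only: sum_distrib_left)
  also have "\<dots> \<le> (\<Sum>z\<in>?Z. A (2 * k + 1) z * (84000 * \<epsilon> ^ 3 * (C1 * C1)))"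
    using \<epsilon> C1_pos by (intro sum_mono mult_left_mono mult_mono sum_H_window_le)
      (auto simp: trace_prob_nonneg H_window_nonneg sum_nonneg)
  also have "\<dots> = (\<Sum>z\<in>?Z. A (2 * k + 1) z) * (84000 * \<epsilon> ^ 3 * (C1 * C1))"
    by (rule sum_distrib_right[symmetric])
  finally have far: "(\<Sum>z\<in>?Z. \<Sum>i\<le>L. \<Sum>j\<in>{j\<in>{..L}. ?far i j}. Y_cut i z * X j z)
      \<le> (\<Sum>z\<in>?Z. A (2 * k + 1) z) * (84000 * \<epsilon> ^ 3 * (C1 * C1))" .
  have "(\<Sum>z\<in>?Z. A (2 * k + 1) z * (\<Sum>j\<le>L. X j z)\<^sup>2) \<le> (\<Sum>z\<in>?Z. A (2 * k + 1) z) * (C3 * \<epsilon> ^ 3)"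
    unfolding split C3_def using add_mono[OF near far] by (simp add: power2_eq_square algebra_simps)
  also have "\<dots> \<le> 1 * (C3 * \<epsilon> ^ 3)"
    using sum_trace_prob_le C1_pos C2_pos \<epsilon> by (intro mult_right_mono) (auto simp: C3_def)
  finally show ?thesis by simp
qed

section \<open>The contribution of atypical words\<close>

definition bad :: "bool list \<Rightarrow> real" where "bad a = (if \<Lambda> < \<bar>drift k a\<bar> then 1 else 0)"

lemma bad_part_le:
  "\<bar>Y k j z - Y_cut j z\<bar> \<le> (if j + 2 \<le> length z then
     (A k (take j z) * A (Suc k) (drop (j + 2) z) + A (Suc k) (take j z) * A k (drop (j + 2) z)) *
     (bad (take j z) + bad (drop (j + 2) z)) else 0)"
proof (cases "j + 2 \<le> length z")
  case True
  define a c where "a = take j z" and "c = drop (j + 2) z"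
  define D where "D = A k a * A (Suc k) c - A (Suc k) a * A k c"
  have D: "\<bar>D\<bar> \<le> A k a * A (Suc k) c + A (Suc k) a * A k c"
    unfolding D_def by (rule order_trans[OF abs_triangle_ineq4]) (simp add: abs_mult trace_prob_nonneg)
  have cc: "0 \<le> cut a * cut c" "cut a * cut c \<le> 1" using cut_bounds by (auto intro: mult_le_one)
  have b: "\<bar>1 - cut a * cut c\<bar> \<le> bad a + bad c"
    using cc cut_eq_1[of a] cut_eq_1[of c] by (auto simp: bad_def)
  have "Y k j z - Y_cut j z = (1 - cut a * cut c) * (((1 - q)\<^sup>2 * sgnbit z j) * D)"
    using True by (simp add: Y_cut_def Y_def a_def c_def D_def algebra_simps)
  hence "\<bar>Y k j z - Y_cut j z\<bar> = \<bar>1 - cut a * cut c\<bar> * (\<bar>(1 - q)\<^sup>2 * sgnbit z j\<bar> * \<bar>D\<bar>)"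
    by (simp add: abs_mult)
  also have "\<dots> \<le> (bad a + bad c) * (1 * (A k a * A (Suc k) c + A (Suc k) a * A k c))"
    using b D coeff_le_1[of z j] by (intro mult_mono) (auto simp: bad_def)
  finally show ?thesis using True by (simp add: a_def c_def mult.commute)
qed (simp add: Y_def Y_cut_def)

lemma bad_total_le:
  "(\<Sum>z\<in>lists_upto L. \<Sum>j\<le>L. \<bar>Y k j z - Y_cut j z\<bar>)
    \<le> 8 * ((\<Sum>a\<in>lists_upto L. bad a * A k a) + (\<Sum>a\<in>lists_upto L. bad a * A (Suc k) a))"
proof -
  let ?Z = "lists_upto L"
  let ?f = "\<lambda>a c. (A k a * A (Suc k) c + A (Suc k) a * A k c) * (bad a + bad c)"
  define B B' where "B = (\<Sum>a\<in>?Z. bad a * A k a)" and "B' = (\<Sum>a\<in>?Z. bad a * A (Suc k) a)"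
  define S S' where "S = (\<Sum>a\<in>?Z. A k a)" and "S' = (\<Sum>a\<in>?Z. A (Suc k) a)"
  have nn: "0 \<le> B" "0 \<le> B'" by (auto simp: B_def B'_def bad_def trace_prob_nonneg intro!: sum_nonneg)
  have SS: "S \<le> 1" "S' \<le> 1" unfolding S_def S'_def by (rule sum_trace_prob_le)+
  have "(\<Sum>z\<in>?Z. \<Sum>j\<le>L. \<bar>Y k j z - Y_cut j z\<bar>) \<le>
      (\<Sum>z\<in>?Z. \<Sum>j\<le>L. if j + 2 \<le> length z then ?f (take j z) (drop (j + 2) z) else 0)"
    by (intro sum_mono bad_part_le)
  also have "\<dots> \<le> 4 * (\<Sum>a\<in>?Z. \<Sum>c\<in>?Z. ?f a c)"
    by (rule sum_splices_le) (simp add: trace_prob_nonneg bad_def)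
  also have "(\<Sum>a\<in>?Z. \<Sum>c\<in>?Z. ?f a c) = B * S' + S * B' + B' * S + S' * B"
    unfolding B_def B'_def S_def S'_def sum_product by (simp add: sum.distrib[symmetric] algebra_simps)
  also have "\<dots> \<le> B * 1 + 1 * B' + B' * 1 + 1 * B"
    using nn SS by (intro add_mono mult_left_mono mult_right_mono) auto
  finally show ?thesis unfolding B_def[symmetric] B'_def[symmetric] by simp
qed

text \<open>One additional block moves the drift by less than 1, so the second bound is the tail
  estimate at \<open>Suc k\<close> with threshold \<open>\<Lambda> - 1\<close>. The constant 16
  covers both cases.\<close>

lemma bad_mass_le:
  assumes J: "2 * real J \<le> \<Lambda> - 1" and \<Lambda>2: "2 \<le> \<Lambda>"
  shows "(\<Sum>a\<in>lists_upto L. bad a * A k a) \<le> 2 / (1 + \<Lambda> / (16 * real k)) ^ J"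
    and "(\<Sum>a\<in>lists_upto L. bad a * A (Suc k) a) \<le> 2 / (1 + \<Lambda> / (16 * real k)) ^ J"
proof -
  have k1: "1 \<le> real k" using k_pos by simp
  have "q\<^sup>2 * real k \<le> real k" using q2 k_pos by simp
  hence Jk: "J \<le> k" using J \<Lambda>_small \<Lambda>_ge_1 by linarith
  have pos: "0 < 1 + \<Lambda> / (16 * real k)" using \<Lambda>_ge_1 k_pos by (simp add: add_pos_nonneg)
  have "(\<Sum>a\<in>lists_upto L. bad a * A k a) = (\<Sum>a\<in>lists_upto L. if \<Lambda> < \<bar>drift k a\<bar> then A k a else 0)"
    by (intro sum.cong) (auto simp: bad_def)
  also have "\<dots> \<le> 2 / (1 + \<Lambda> / (4 * real k)) ^ J"
    using J \<Lambda>_ge_1 Jk k_pos by (intro A_tail) auto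
  also have "\<dots> \<le> 2 / (1 + \<Lambda> / (16 * real k)) ^ J"
  proof (rule divide_left_mono)
    have "\<Lambda> / (16 * real k) \<le> \<Lambda> / (4 * real k)" using \<Lambda>_ge_1 k_pos by (intro divide_left_mono) auto
    thus "(1 + \<Lambda> / (16 * real k)) ^ J \<le> (1 + \<Lambda> / (4 * real k)) ^ J" using pos by (intro power_mono) auto
    show "0 < (1 + \<Lambda> / (4 * real k)) ^ J * (1 + \<Lambda> / (16 * real k)) ^ J"
      using pos \<Lambda>_ge_1 k_pos by (intro mult_pos_pos zero_less_power) (auto simp: add_pos_nonneg)
  qed simp
  finally show "(\<Sum>a\<in>lists_upto L. bad a * A k a) \<le> 2 / (1 + \<Lambda> / (16 * real k)) ^ J" .
  have "(\<Sum>a\<in>lists_upto L. bad a * A (Suc k) a) \<le> (\<Sum>a\<in>lists_upto L. if \<Lambda> - 1 < \<bar>drift (Suc k) a\<bar> then A (Suc k) a else 0)"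
  proof (rule sum_mono)
    fix a
    have "drift (Suc k) a = drift k a - (1 - q\<^sup>2)" using drift_shift[of k 1 a] by simp
    hence "\<Lambda> < \<bar>drift k a\<bar> \<Longrightarrow> \<Lambda> - 1 < \<bar>drift (Suc k) a\<bar>" using q2 by linarith
    thus "bad a * A (Suc k) a \<le> (if \<Lambda> - 1 < \<bar>drift (Suc k) a\<bar> then A (Suc k) a else 0)"
      by (auto simp: bad_def trace_prob_nonneg)
  qed
  also have "\<dots> \<le> 2 / (1 + (\<Lambda> - 1) / (4 * real (Suc k))) ^ J"
    using J \<Lambda>2 Jk by (intro A_tail) auto
  also have "\<dots> \<le> 2 / (1 + \<Lambda> / (16 * real k)) ^ J"
  proof (rule divide_left_mono)
    have "\<Lambda> / (16 * real k) = (\<Lambda> / 2) / (8 * real k)" by simp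
    also have "\<dots> \<le> (\<Lambda> - 1) / (4 * real (Suc k))"
      using \<Lambda>2 k1 by (intro frac_le) auto
    finally show "(1 + \<Lambda> / (16 * real k)) ^ J \<le> (1 + (\<Lambda> - 1) / (4 * real (Suc k))) ^ J"
      using pos by (intro power_mono) auto
    show "0 < (1 + (\<Lambda> - 1) / (4 * real (Suc k))) ^ J * (1 + \<Lambda> / (16 * real k)) ^ J"
      using pos \<Lambda>2 by (intro mult_pos_pos zero_less_power) (auto simp: add_pos_nonneg)
  qed simp
  finally show "(\<Sum>a\<in>lists_upto L. bad a * A (Suc k) a) \<le> 2 / (1 + \<Lambda> / (16 * real k)) ^ J" .
qed

text \<open>Apply \<open>sqrt_diff_sq_le\<close> pointwise with \<open>R = A (2 * k + 1) z\<close>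
  and \<open>c = q^2\<close>: the truncated terms enter through their second moment, the atypical
  ones through their total mass.\<close>

theorem hellinger_le:
  assumes J: "2 * real J \<le> \<Lambda> - 1" and \<Lambda>2: "2 \<le> \<Lambda>"
  shows "(\<Sum>z\<in>lists_upto L. (sqrt (trace_prob q (defect_left k) z) - sqrt (trace_prob q (defect_right k) z))\<^sup>2)
    \<le> 64 / (1 + \<Lambda> / (16 * real k)) ^ J + 2 / q\<^sup>2 * (C3 * \<epsilon> ^ 3)"
proof -
  let ?Z = "lists_upto L"
  let ?b = "\<lambda>z. \<Sum>j\<le>L. Y k j z - Y_cut j z"
  have "(\<Sum>z\<in>?Z. (sqrt (trace_prob q (defect_left k) z) - sqrt (trace_prob q (defect_right k) z))\<^sup>2)
      \<le> (\<Sum>z\<in>?Z. 2 * \<bar>?b z\<bar> + 2 / q\<^sup>2 * (A (2 * k + 1) z * (\<Sum>j\<le>L. X j z)\<^sup>2))"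
  proof (rule sum_mono, rule sqrt_diff_sq_le)
    fix z assume z: "z \<in> ?Z"
    have "(\<Sum>j\<le>length z. Y k j z) = (\<Sum>j\<le>L. Y k j z)"
      by (rule sum.mono_neutral_left) (use z in \<open>auto simp: Y_def\<close>)
    thus "trace_prob q (defect_left k) z - trace_prob q (defect_right k) z = (\<Sum>j\<le>L. Y_cut j z) + ?b z"
      by (simp add: trace_prob_diff_eq_sum_Y sum_subtractf)
    show "(\<Sum>j\<le>L. Y_cut j z) = A (2 * k + 1) z * (\<Sum>j\<le>L. X j z)"
      by (simp add: Y_cut_eq_X sum_distrib_left)
  qed (use q2 trace_prob_ge_alt in \<open>auto simp: trace_prob_nonneg\<close>)
  also have "\<dots> = 2 * (\<Sum>z\<in>?Z. \<bar>?b z\<bar>) + 2 / q\<^sup>2 * (\<Sum>z\<in>?Z. A (2 * k + 1) z * (\<Sum>j\<le>L. X j z)\<^sup>2)"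
    by (simp only: sum.distrib sum_distrib_left)
  also have "\<dots> \<le> 2 * (32 / (1 + \<Lambda> / (16 * real k)) ^ J) + 2 / q\<^sup>2 * (C3 * \<epsilon> ^ 3)"
  proof (intro add_mono mult_left_mono second_moment_le)
    have "(\<Sum>z\<in>?Z. \<bar>?b z\<bar>) \<le> (\<Sum>z\<in>?Z. \<Sum>j\<le>L. \<bar>Y k j z - Y_cut j z\<bar>)"
      by (intro sum_mono sum_abs)
    also have "\<dots> \<le> 32 / (1 + \<Lambda> / (16 * real k)) ^ J"
      using bad_total_le[of L] bad_mass_le[OF assms, of L] by simp
    finally show "(\<Sum>z\<in>?Z. \<bar>?b z\<bar>) \<le> 32 / (1 + \<Lambda> / (16 * real k)) ^ J" .
  qed (use q2 in auto)
  finally show ?thesis by simp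
qed

end

section \<open>From a pair of blocks to random strings\<close>

abbreviation lists_len :: "'a set \<Rightarrow> nat \<Rightarrow> 'a list set" where
  "lists_len Z n \<equiv> {zs. set zs \<subseteq> Z \<and> length zs = n}"

lemma pmf_replicate_pmf:
  "pmf (replicate_pmf n p) zs = (if length zs = n then prod_list (map (pmf p) zs) else 0)"
proof (induction n arbitrary: zs)
  case 0
  show ?case by (auto simp: indicator_def)
next
  case (Suc n)
  have inj: "inj (\<lambda>(x, xs). x # xs)" by (auto simp: inj_def)
  have eq: "replicate_pmf (Suc n) p = map_pmf (\<lambda>(x, xs). x # xs) (pair_pmf p (replicate_pmf n p))"
    by (simp add: map_pmf_def pair_pmf_def bind_assoc_pmf bind_return_pmf)
  show ?case
  proof (cases zs)
    case Nil
    thus ?thesis by (auto simp: eq pmf_eq_0_set_pmf)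
  next
    case (Cons z zs')
    thus ?thesis unfolding eq using pmf_map_inj'[OF inj, of "pair_pmf p (replicate_pmf n p)" "(z, zs')"]
      by (simp add: pmf_pair Suc.IH)
  qed
qed

lemma sum_lists_len_Suc:
  fixes f :: "'a list \<Rightarrow> real"
  shows "(\<Sum>zs\<in>lists_len Z (Suc n). f zs) = (\<Sum>z\<in>Z. \<Sum>zs\<in>lists_len Z n. f (z # zs))"
proof -
  have "lists_len Z (Suc n) = (\<lambda>(z, zs). z # zs) ` (Z \<times> lists_len Z n)"
    by (auto simp: length_Suc_conv image_iff)
  moreover have "inj_on (\<lambda>(z, zs). z # zs) (Z \<times> lists_len Z n)" by (auto simp: inj_on_def)
  ultimately show ?thesis
    by (simp add: sum.reindex sum.cartesian_product case_prod_unfold)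
qed

lemma sum_prod_list:
  fixes h :: "'a \<Rightarrow> real"
  shows "(\<Sum>zs\<in>lists_len Z n. prod_list (map h zs)) = (\<Sum>z\<in>Z. h z) ^ n"
proof (induction n)
  case 0
  have "lists_len Z 0 = {[]}" by auto
  thus ?case by simp
next
  case (Suc n)
  show ?case unfolding sum_lists_len_Suc
    by (simp add: sum_distrib_left[symmetric] Suc.IH sum_distrib_right)
qed

lemma sqrt_prod_list:
  "sqrt (prod_list (map f zs) * prod_list (map g zs)) = prod_list (map (\<lambda>z. sqrt (f z * g z)) zs)"
  by (induction zs) (auto simp: real_sqrt_mult mult_ac)

text \<open>The product of \<open>f\<close> and \<open>g\<close> is that of their minimum and
  maximum; use Cauchy-Schwarz and the bound 2 for the sum of the maxima.\<close>

lemma sum_min_ge: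
  fixes f g :: "'a \<Rightarrow> real"
  assumes nn: "\<And>x. 0 \<le> f x" "\<And>x. 0 \<le> g x" and le: "sum f S \<le> 1" "sum g S \<le> 1"
  shows "(\<Sum>x\<in>S. sqrt (f x * g x))\<^sup>2 / 2 \<le> (\<Sum>x\<in>S. min (f x) (g x))"
proof -
  have eq: "sqrt (f x * g x) = sqrt (min (f x) (g x)) * sqrt (max (f x) (g x))" for x
    by (simp add: real_sqrt_mult[symmetric] min_def max_def mult.commute)
  have "(\<Sum>x\<in>S. sqrt (f x * g x))\<^sup>2 \<le>
      (\<Sum>x\<in>S. (sqrt (min (f x) (g x)))\<^sup>2) * (\<Sum>x\<in>S. (sqrt (max (f x) (g x)))\<^sup>2)"
    unfolding eq by (rule Cauchy_Schwarz_ineq_sum)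
  also have "\<dots> = (\<Sum>x\<in>S. min (f x) (g x)) * (\<Sum>x\<in>S. max (f x) (g x))"
    using nn by (simp add: le_max_iff_disj)
  also have "\<dots> \<le> (\<Sum>x\<in>S. min (f x) (g x)) * 2"
  proof (rule mult_left_mono)
    have "(\<Sum>x\<in>S. max (f x) (g x)) \<le> (\<Sum>x\<in>S. f x + g x)"
      using nn by (intro sum_mono) (auto simp: add_increasing add_increasing2)
    thus "(\<Sum>x\<in>S. max (f x) (g x)) \<le> 2" using le by (simp add: sum.distrib)
  qed (use nn in \<open>auto intro!: sum_nonneg\<close>)
  finally show ?thesis by simp
qed

lemma exp_minus_le: "0 \<le> h \<Longrightarrow> h \<le> 1 \<Longrightarrow> exp (- h) \<le> 1 - h / 2" for h :: real
proof -
  assume h: "0 \<le> h" "h \<le> 1"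
  have "exp (- h) \<le> 1 / (1 + h)"
    using exp_ge_add_one_self[of h] h by (simp add: exp_minus field_simps)
  also have "\<dots> \<le> 1 - h / 2"
  proof -
    have "h * h \<le> h * 1" using h by (intro mult_left_mono) auto
    hence "1 \<le> (1 - h / 2) * (1 + h)" by (simp add: algebra_simps)
    thus ?thesis using h by (simp add: pos_divide_le_eq)
  qed
  finally show ?thesis .
qed

lemma prob_map_pmf: "measure_pmf.prob (map_pmf f p) S = measure_pmf.prob p {x. f x \<in> S}"
  by (simp add: vimage_def)

lemma prob_bind_pmf:
  assumes "finite F" "set_pmf p \<subseteq> F"
  shows "measure_pmf.prob (p \<bind> f) S = (\<Sum>x\<in>F. pmf p x * measure_pmf.prob (f x) S)"
proof -
  have *: "measure_pmf.prob r S = pmf (map_pmf (\<lambda>x. x \<in> S) r) True" for r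
    by (simp add: pmf_map vimage_def)
  have "measure_pmf.prob (p \<bind> f) S = pmf (p \<bind> (\<lambda>x. map_pmf (\<lambda>x. x \<in> S) (f x))) True"
    unfolding * by (simp add: map_bind_pmf)
  also have "\<dots> = (\<Sum>x\<in>F. pmf p x * pmf (map_pmf (\<lambda>x. x \<in> S) (f x)) True)"
    unfolding pmf_bind using assms by (subst integral_measure_pmf[of F]) auto
  finally show ?thesis unfolding * .
qed

context deletion
begin

lemma pmf_traces:
  "pmf (traces_pmf q T x) ts = (if length ts = T then prod_list (map (trace_prob q x) ts) else 0)"
  using q0 q1 by (simp add: traces_pmf_def pmf_replicate_pmf pmf_trace cong: map_cong)

lemma set_traces: "set_pmf (traces_pmf q T x) \<subseteq> lists_len (lists_upto (length x)) T"
  unfolding traces_pmf_def set_replicate_pmf using set_trace_pmf[of x] by (auto simp: lists_eq_set)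

lemma finite_lists_len_upto [simp]: "finite (lists_len (lists_upto L) T)"
  by (rule finite_lists_length_eq) simp

text \<open>The Bhattacharyya coefficient is 1 minus half the squared Hellinger distance, hence at
  least exp(-h), and it is multiplicative over independent traces. \<open>sum_min_ge\<close>
  converts it into overlap.\<close>

lemma overlap_ge:
  fixes T :: nat
  assumes "length x \<le> L" "length y \<le> L"
    and h: "(\<Sum>z\<in>lists_upto L. (sqrt (trace_prob q x z) - sqrt (trace_prob q y z))\<^sup>2) \<le> h" "h \<le> 1"
  shows "exp (- (2 * real T * h)) / 2 \<le>
    (\<Sum>ts\<in>lists_len (lists_upto L) T. min (pmf (traces_pmf q T x) ts) (pmf (traces_pmf q T y) ts))"
proof -
  let ?Z = "lists_upto L"
  let ?BC = "\<Sum>z\<in>?Z. sqrt (trace_prob q x z * trace_prob q y z)"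
  have h0: "0 \<le> h" using h(1) by (rule order_trans[rotated]) (auto intro: sum_nonneg)
  have "(\<Sum>z\<in>?Z. (sqrt (trace_prob q x z) - sqrt (trace_prob q y z))\<^sup>2) =
      (\<Sum>z\<in>?Z. trace_prob q x z + trace_prob q y z - 2 * sqrt (trace_prob q x z * trace_prob q y z))"
    by (intro sum.cong refl) (simp add: power2_diff trace_prob_nonneg real_sqrt_mult)
  also have "\<dots> = 2 - 2 * ?BC"
    using sum_trace_prob assms(1,2) by (simp add: sum.distrib sum_subtractf sum_distrib_left)
  finally have "1 - h / 2 \<le> ?BC" using h by linarith
  hence BC: "exp (- h) \<le> ?BC" using exp_minus_le[OF h0 h(2)] by linarith
  have "exp (- (2 * real T * h)) = (exp (- h) ^ T)\<^sup>2"
    using exp_of_nat_mult[of "T * 2" "- h"] by (simp add: power_mult mult_ac)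
  also have "\<dots> \<le> (?BC ^ T)\<^sup>2"
    using BC by (intro power_mono) auto
  also have "?BC ^ T = (\<Sum>ts\<in>lists_len ?Z T. sqrt (pmf (traces_pmf q T x) ts * pmf (traces_pmf q T y) ts))"
    unfolding sum_prod_list[symmetric] by (intro sum.cong refl) (simp add: pmf_traces sqrt_prod_list)
  finally have 1: "exp (- (2 * real T * h)) \<le>
      (\<Sum>ts\<in>lists_len ?Z T. sqrt (pmf (traces_pmf q T x) ts * pmf (traces_pmf q T y) ts))\<^sup>2" .
  have s: "(\<Sum>ts\<in>lists_len ?Z T. pmf (traces_pmf q T w) ts) \<le> 1" if "length w \<le> L" for w
  proof -
    have "set_pmf (traces_pmf q T w) \<subseteq> lists_len ?Z T"
      using set_traces[of T w] that by fastforce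
    thus ?thesis using sum_pmf_eq_1[of "lists_len ?Z T"] by simp
  qed
  show ?thesis
    using sum_min_ge[of "pmf (traces_pmf q T x)" "pmf (traces_pmf q T y)" "lists_len ?Z T"] s assms(1,2) 1
    by simp
qed

lemma traces_append:
  "traces_pmf q T (u @ v) = traces_pmf q T u \<bind> (\<lambda>s. map_pmf (map2 (@) s) (traces_pmf q T v))"
proof (induction T)
  case 0
  show ?case by (simp add: traces_pmf_def bind_return_pmf)
next
  case (Suc T)
  have app: "trace_pmf q (u @ v) = trace_pmf q u \<bind> (\<lambda>a. trace_pmf q v \<bind> (\<lambda>b. return_pmf (a @ b)))"
    using q0 q1 by (simp add: trace_pmf_append map_pmf_def pair_pmf_def bind_assoc_pmf bind_return_pmf)
  have rec: "traces_pmf q (Suc T) w = trace_pmf q w \<bind> (\<lambda>a. traces_pmf q T w \<bind> (\<lambda>s. return_pmf (a # s)))" for w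
    by (simp add: traces_pmf_def)
  have "traces_pmf q (Suc T) (u @ v) =
      trace_pmf q u \<bind> (\<lambda>a. trace_pmf q v \<bind> (\<lambda>b. traces_pmf q T u \<bind> (\<lambda>s. traces_pmf q T v \<bind>
        (\<lambda>t. return_pmf ((a @ b) # map2 (@) s t)))))"
    by (simp add: rec app Suc.IH map_pmf_def bind_assoc_pmf bind_return_pmf)
  \<comment> \<open>Independence allows all traces of \<open>u\<close> to be drawn before those of
    \<open>v\<close>.\<close>
  also have "\<dots> = trace_pmf q u \<bind> (\<lambda>a. traces_pmf q T u \<bind> (\<lambda>s. trace_pmf q v \<bind> (\<lambda>b. traces_pmf q T v \<bind>
        (\<lambda>t. return_pmf ((a @ b) # map2 (@) s t)))))"
    by (intro bind_pmf_cong refl bind_commute_pmf)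
  also have "\<dots> = traces_pmf q (Suc T) u \<bind> (\<lambda>s. map_pmf (map2 (@) s) (traces_pmf q (Suc T) v))"
    by (simp add: rec map_pmf_def bind_assoc_pmf bind_return_pmf)
  finally show ?case .
qed

text \<open>Without the factor 1 / 2^n the bounds for successive blocks simply multiply.\<close>

definition success :: "nat \<Rightarrow> nat \<Rightarrow> (bool list list \<Rightarrow> bool list) \<Rightarrow> real" where
  "success T n G = (\<Sum>x | length x = n. measure_pmf.prob (traces_pmf q T x) {ts. G ts = x})"

lemma finite_length_eq [simp]: "finite {x :: bool list. length x = n}"
  using finite_lists_length_eq[of "UNIV :: bool set" n] by simp

lemma card_length_eq: "card {x :: bool list. length x = n} = 2 ^ n"
  using card_lists_length_eq[of "UNIV :: bool set" n] by simp

lemma success_nonneg: "0 \<le> success T n G"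
  by (simp add: success_def sum_nonneg)

lemma success_le: "success T n G \<le> 2 ^ n"
proof -
  have "success T n G \<le> (\<Sum>x\<in>{x :: bool list. length x = n}. 1 :: real)"
    unfolding success_def by (intro sum_mono) simp
  thus ?thesis by (simp add: card_length_eq)
qed

lemma sum_length_add:
  fixes f :: "bool list \<Rightarrow> real"
  shows "(\<Sum>x | length x = m + n. f x) = (\<Sum>u | length u = m. \<Sum>v | length v = n. f (u @ v))"
proof -
  have "{x :: bool list. length x = m + n} = (\<lambda>(u, v). u @ v) ` ({u. length u = m} \<times> {v. length v = n})"
  proof (intro equalityI subsetI)
    fix x :: "bool list" assume "x \<in> {x. length x = m + n}"
    thus "x \<in> (\<lambda>(u, v). u @ v) ` ({u. length u = m} \<times> {v. length v = n})"
      by (intro image_eqI[of _ _ "(take m x, drop m x)"]) auto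
  qed auto
  moreover have "inj_on (\<lambda>(u, v). u @ v) ({u :: bool list. length u = m} \<times> {v. length v = n})"
    by (auto simp: inj_on_def)
  ultimately show ?thesis
    by (simp add: sum.reindex sum.cartesian_product case_prod_unfold)
qed

text \<open>Even if the traces of the first block are revealed separately, guessing that block succeeds with
  total weight at most the sum over traces of the largest likelihood, and \<open>x\<close> and \<open>y\<close> compete for
  their common part.\<close>

lemma success_block:
  assumes xy: "length x = m" "length y = m" "x \<noteq> y"
    and \<mu>: "\<mu> \<le> (\<Sum>ts\<in>lists_len (lists_upto m) T. min (pmf (traces_pmf q T x) ts) (pmf (traces_pmf q T y) ts))"
    and B: "\<And>G. success T n G \<le> B"
  shows "success T (m + n) G \<le> (2 ^ m - \<mu>) * B"
proof -
  let ?S = "lists_len (lists_upto m) T"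
  let ?U = "{u :: bool list. length u = m}"
  let ?V = "{v :: bool list. length v = n}"
  let ?p = "\<lambda>u. pmf (traces_pmf q T u)"
  let ?P = "\<lambda>v. measure_pmf.prob (traces_pmf q T v)"
  define M where "M s = (\<Sum>u\<in>?U. ?p u s) - min (?p x s) (?p y s)" for s
  \<comment> \<open>One of \<open>x\<close> and \<open>y\<close> differs from \<open>u\<close>, and
    its likelihood is at least the subtracted minimum.\<close>
  have M: "?p u s \<le> M s" if "u \<in> ?U" for u s
  proof -
    obtain w where w: "w \<in> ?U" "w \<noteq> u" "min (?p x s) (?p y s) \<le> ?p w s"
      using xy by (cases "u = x") auto
    have "?p u s + ?p w s = (\<Sum>i\<in>{u, w}. ?p i s)" using w by simp
    also have "\<dots> \<le> (\<Sum>i\<in>?U. ?p i s)" using w that by (intro sum_mono2) auto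
    finally show ?thesis using w by (simp add: M_def)
  qed
  have M0: "0 \<le> M s" for s using order_trans[OF pmf_nonneg M[of x s]] xy by auto
  have "success T (m + n) G = (\<Sum>u\<in>?U. \<Sum>v\<in>?V. \<Sum>s\<in>?S. ?p u s * ?P v {t. G (map2 (@) s t) = u @ v})"
    unfolding success_def sum_length_add
  proof (intro sum.cong refl)
    fix u v assume u: "u \<in> ?U"
    hence "set_pmf (traces_pmf q T u) \<subseteq> ?S" using set_traces[of T u] by auto
    thus "?P (u @ v) {ts. G ts = u @ v} = (\<Sum>s\<in>?S. ?p u s * ?P v {t. G (map2 (@) s t) = u @ v})"
      unfolding traces_append by (subst prob_bind_pmf) (auto simp: prob_map_pmf)
  qed
  also have "\<dots> \<le> (\<Sum>u\<in>?U. \<Sum>v\<in>?V. \<Sum>s\<in>?S. M s * ?P v {t. G (map2 (@) s t) = u @ v})"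
    by (intro sum_mono mult_right_mono M) auto
  also have "\<dots> = (\<Sum>s\<in>?S. M s * (\<Sum>v\<in>?V. \<Sum>u\<in>?U. ?P v {t. G (map2 (@) s t) = u @ v}))"
  proof -
    have "(\<Sum>u\<in>?U. \<Sum>v\<in>?V. \<Sum>s\<in>?S. M s * ?P v {t. G (map2 (@) s t) = u @ v})
        = (\<Sum>v\<in>?V. \<Sum>u\<in>?U. \<Sum>s\<in>?S. M s * ?P v {t. G (map2 (@) s t) = u @ v})"
      by (rule sum.swap)
    also have "\<dots> = (\<Sum>v\<in>?V. \<Sum>s\<in>?S. \<Sum>u\<in>?U. M s * ?P v {t. G (map2 (@) s t) = u @ v})"
      by (intro sum.cong refl sum.swap)
    also have "\<dots> = (\<Sum>s\<in>?S. \<Sum>v\<in>?V. \<Sum>u\<in>?U. M s * ?P v {t. G (map2 (@) s t) = u @ v})"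
      by (rule sum.swap)
    finally show ?thesis by (simp only: sum_distrib_left)
  qed
  also have "\<dots> \<le> (\<Sum>s\<in>?S. M s * B)"
  proof (intro sum_mono mult_left_mono M0)
    fix s
    \<comment> \<open>For fixed traces \<open>s\<close> of the first block, \<open>G\<close>
      followed by \<open>drop m\<close> is a reconstruction of the remaining string, and the events
      for different \<open>u\<close> are disjoint.\<close>
    have "(\<Sum>v\<in>?V. \<Sum>u\<in>?U. ?P v {t. G (map2 (@) s t) = u @ v}) \<le>
        (\<Sum>v\<in>?V. ?P v {t. drop m (G (map2 (@) s t)) = v})"
    proof (rule sum_mono)
      fix v
      have "(\<Sum>u\<in>?U. ?P v {t. G (map2 (@) s t) = u @ v}) = ?P v (\<Union>u\<in>?U. {t. G (map2 (@) s t) = u @ v})"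
        by (rule measure_pmf.finite_measure_finite_Union[symmetric]) (auto simp: disjoint_family_on_def)
      also have "\<dots> \<le> ?P v {t. drop m (G (map2 (@) s t)) = v}"
        by (rule measure_pmf.finite_measure_mono) auto
      finally show "(\<Sum>u\<in>?U. ?P v {t. G (map2 (@) s t) = u @ v}) \<le> ?P v {t. drop m (G (map2 (@) s t)) = v}" .
    qed
    also have "\<dots> \<le> B" using B[of "\<lambda>t. drop m (G (map2 (@) s t))"] by (simp add: success_def)
    finally show "(\<Sum>v\<in>?V. \<Sum>u\<in>?U. ?P v {t. G (map2 (@) s t) = u @ v}) \<le> B" .
  qed
  also have "\<dots> = (\<Sum>s\<in>?S. M s) * B" by (simp add: sum_distrib_right)
  also have "(\<Sum>s\<in>?S. M s) = (\<Sum>u\<in>?U. \<Sum>s\<in>?S. ?p u s) - (\<Sum>s\<in>?S. min (?p x s) (?p y s))"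
    unfolding M_def sum_subtractf by (subst sum.swap) simp
  also have "(\<Sum>u\<in>?U. \<Sum>s\<in>?S. ?p u s) = (\<Sum>u\<in>?U. 1 :: real)"
  proof (intro sum.cong refl sum_pmf_eq_1)
    fix u assume "u \<in> ?U"
    thus "set_pmf (traces_pmf q T u) \<subseteq> ?S" using set_traces[of T u] by auto
  qed simp
  also have "(\<Sum>u\<in>?U. 1 :: real) = (2 ^ m :: real)" by (simp add: card_length_eq)
  also have "(2 ^ m - (\<Sum>s\<in>?S. min (?p x s) (?p y s))) * B \<le> (2 ^ m - \<mu>) * B"
    using \<mu> order_trans[OF success_nonneg B] by (intro mult_right_mono) auto
  finally show ?thesis .
qed

lemma success_blocks:
  assumes xy: "length x = m" "length y = m" "x \<noteq> y"
    and \<mu>: "\<mu> \<le> (\<Sum>ts\<in>lists_len (lists_upto m) T. min (pmf (traces_pmf q T x) ts) (pmf (traces_pmf q T y) ts))"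
  shows "success T (b * m + r) G \<le> (2 ^ m - \<mu>) ^ b * 2 ^ r"
proof (induction b arbitrary: G)
  case 0
  show ?case using success_le by simp
next
  case (Suc b)
  show ?case using success_block[OF xy \<mu> Suc.IH, of G] by (simp add: add.assoc mult.assoc)
qed

theorem reconstruction_prob_le:
  assumes xy: "length x = m" "length y = m" "x \<noteq> y"
    and \<mu>: "\<mu> \<le> (\<Sum>ts\<in>lists_len (lists_upto m) T. min (pmf (traces_pmf q T x) ts) (pmf (traces_pmf q T y) ts))"
    and \<mu>1: "\<mu> \<le> 1"
  shows "reconstruction_prob q n T G \<le> exp (- (real (n div m) * \<mu> / 2 ^ m))"
proof -
  have n: "n = (n div m) * m + n mod m" by simp
  have "reconstruction_prob q n T G = success T n G / 2 ^ n"
    by (simp add: reconstruction_prob_def success_def sum_divide_distrib)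
  also have "\<dots> \<le> ((2 ^ m - \<mu>) ^ (n div m) * 2 ^ (n mod m)) / 2 ^ n"
    using success_blocks[OF xy \<mu>, of "n div m" "n mod m" G] by (intro divide_right_mono) simp_all
  also have "(2 :: real) ^ n = (2 ^ m) ^ (n div m) * 2 ^ (n mod m)"
    by (subst n) (simp only: power_add power_mult mult.commute[of "n div m" m])
  also have "((2 ^ m - \<mu>) ^ (n div m) * 2 ^ (n mod m)) / ((2 ^ m) ^ (n div m) * 2 ^ (n mod m)) = ((2 ^ m - \<mu>) / 2 ^ m) ^ (n div m)"
    by (simp add: power_divide)
  also have "\<dots> \<le> exp (- (\<mu> / 2 ^ m)) ^ (n div m)"
  proof (rule power_mono)
    show "(2 ^ m - \<mu>) / 2 ^ m \<le> exp (- (\<mu> / 2 ^ m))"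
      using exp_ge_add_one_self[of "- (\<mu> / 2 ^ m)"] by (simp add: diff_divide_distrib)
    have "(1 :: real) \<le> 2 ^ m" by simp
    thus "0 \<le> (2 ^ m - \<mu>) / 2 ^ m" using \<mu>1 by (intro divide_nonneg_pos) linarith+
  qed
  also have "\<dots> = exp (- (real (n div m) * \<mu> / 2 ^ m))"
    by (simp add: exp_of_nat_mult[symmetric])
  finally show ?thesis .
qed

lemma length_defect [simp]: "length (defect_left k) = 4 * k + 4" "length (defect_right k) = 4 * k + 4"
  by (auto simp: defect_left_def defect_right_def)

lemma defect_left_neq_right: "defect_left k \<noteq> defect_right k"
proof -
  have "alt (Suc k) = alt k @ [False, True]" using alt_add[of k 1] by (simp add: alt_Suc)
  thus ?thesis by (simp add: defect_left_def defect_right_def)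
qed

end

section \<open>Choice of parameters\<close>

context deletion
begin

text \<open>With \<open>\<Lambda> = k\<^sup>0\<^sup>.\<^sup>5\<^sup>5\<close> the main term is \<open>\<epsilon>\<^sup>3 = k powr (-1.35)\<close> up to constants; any exponent below
  \<open>-5/4\<close> suffices.\<close>

lemma hellinger_asymptotic:
  "\<exists>C>0. \<forall>\<^sub>F k in sequentially. \<forall>L.
     (\<Sum>z\<in>lists_upto L. (sqrt (trace_prob q (defect_left k) z) - sqrt (trace_prob q (defect_right k) z))\<^sup>2) \<le> C * real k powr (-1.35)"
proof -
  define C where "C = 64 + 2 / q\<^sup>2 * (C3 / (q\<^sup>2) ^ 3)"
  have C3: "0 \<le> C3" using C1_pos C2_pos by (simp add: C3_def)
  have C: "0 < C" using C3 q2 by (simp add: C_def add_pos_nonneg)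
  have ev1: "\<forall>\<^sub>F k :: nat in sequentially. 2 \<le> real k powr 0.55" by real_asymp
  have ev2: "\<forall>\<^sub>F k :: nat in sequentially. 1000 * real k powr 0.55 \<le> q\<^sup>2 * real k"
    using q2 by real_asymp
  \<comment> \<open>The right side grows roughly like exp(k^0.1 / 32), faster than any power of k,
    so the atypical words are negligible.\<close>
  have ev3: "\<forall>\<^sub>F k :: nat in sequentially. real k powr 1.35 \<le>
      (1 + real k powr (-0.45) / 16) powr ((real k powr 0.55 - 3) / 2)" by real_asymp
  have "\<forall>\<^sub>F k in sequentially. \<forall>L.
     (\<Sum>z\<in>lists_upto L. (sqrt (trace_prob q (defect_left k) z) - sqrt (trace_prob q (defect_right k) z))\<^sup>2) \<le> C * real k powr (-1.35)"
    using ev1 ev2 ev3 eventually_gt_at_top[of 0]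
  proof eventually_elim
    case (elim k)
    define \<Lambda> where "\<Lambda> = real k powr 0.55"
    define J where "J = nat \<lfloor>(\<Lambda> - 1) / 2\<rfloor>"
    have k: "1 \<le> real k" using elim by simp
    have \<Lambda>2: "2 \<le> \<Lambda>" using elim by (simp add: \<Lambda>_def)
    have "real k powr 1 \<le> real k powr 1.1" using k by (intro powr_mono) auto
    also have "\<dots> = \<Lambda>\<^sup>2" by (simp add: \<Lambda>_def power2_eq_square powr_add[symmetric])
    finally have k\<Lambda>: "real k \<le> \<Lambda>\<^sup>2" using k by simp
    interpret window q k \<Lambda>
      by unfold_locales (use \<Lambda>2 k\<Lambda> elim in \<open>auto simp: \<Lambda>_def\<close>)
    have "real J = of_int \<lfloor>(\<Lambda> - 1) / 2\<rfloor>" using \<Lambda>2 by (simp add: J_def)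
    hence J: "2 * real J \<le> \<Lambda> - 1" "(\<Lambda> - 3) / 2 \<le> real J"
      using floor_correct[of "(\<Lambda> - 1) / 2"] by (simp_all add: field_simps)
    have ratio: "\<Lambda> / real k = real k powr (-0.45)"
      using k powr_diff[of "real k" "0.55" 1] by (simp add: \<Lambda>_def)
    define g where "g = 1 + real k powr (-0.45) / 16"
    have g: "1 \<le> g" by (simp add: g_def)
    have "real k powr 1.35 \<le> g powr ((\<Lambda> - 3) / 2)" using elim by (simp add: g_def \<Lambda>_def)
    also have "\<dots> \<le> g powr real J" using g J by (intro powr_mono) auto
    also have "\<dots> = g ^ J" using g by (simp add: powr_realpow)
    finally have gJ: "real k powr 1.35 \<le> g ^ J" .
    have "64 / g ^ J \<le> 64 / real k powr 1.35"
      using gJ g k by (intro divide_left_mono) auto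
    also have "\<dots> = 64 * real k powr (-1.35)" by (simp add: powr_minus_divide)
    finally have tail: "64 / g ^ J \<le> 64 * real k powr (-1.35)" .
    have eps: "\<epsilon> ^ 3 = real k powr (-1.35) / (q\<^sup>2) ^ 3"
    proof -
      have "\<epsilon> = real k powr (-0.45) / q\<^sup>2" unfolding \<epsilon>_def ratio[symmetric] by simp
      moreover have "(real k powr (-0.45)) ^ 3 = real k powr (-1.35)"
        using k by (simp add: powr_power)
      ultimately show ?thesis by (simp only: power_divide)
    qed
    show ?case
    proof
      fix L
      have "1 + \<Lambda> / (16 * real k) = g" unfolding g_def ratio[symmetric] by simp
      hence "(\<Sum>z\<in>lists_upto L. (sqrt (trace_prob q (defect_left k) z) - sqrt (trace_prob q (defect_right k) z))\<^sup>2)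
          \<le> 64 / g ^ J + 2 / q\<^sup>2 * (C3 * \<epsilon> ^ 3)"
        using hellinger_le[OF J(1) \<Lambda>2, of L] by simp
      also have "\<dots> \<le> 64 * real k powr (-1.35) + 2 / q\<^sup>2 * (C3 * (real k powr (-1.35) / (q\<^sup>2) ^ 3))"
        using tail by (simp add: eps)
      also have "\<dots> = C * real k powr (-1.35)" by (simp add: C_def algebra_simps)
      finally show "(\<Sum>z\<in>lists_upto L. (sqrt (trace_prob q (defect_left k) z) - sqrt (trace_prob q (defect_right k) z))\<^sup>2) \<le> C * real k powr (-1.35)" .
    qed
  qed
  with C show ?thesis by blast
qed

end

theorem proposition1p5:
  fixes q :: real
  assumes "0 < q" and "q < 1"
  shows "\<exists>c::real. 0 < c \<and>
    (\<forall>\<^sub>F n::nat in sequentially.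
       let T = nat \<lceil>c * ln (real n) powr (9/4) / sqrt (ln (ln (real n)))\<rceil> in
       \<forall>G \<in> {ts :: bool list list. length ts = T} \<rightarrow> {x. length x = n}.
         reconstruction_prob q n T G \<le> exp (- (real n powr 0.15)))"
\<comment> \<open>The exponent of T times the Hellinger distance is 9/4 - 1.35 = 0.9, below 1. Hence
  T traces cost only exp(-o(log n)) of the overlap, and the constant 1 suffices.\<close>
proof (intro exI[of _ "1 :: real"] conjI)
  interpret deletion q using assms by unfold_locales
  obtain C where C: "0 < C" and hell: "\<forall>\<^sub>F k in sequentially. \<forall>L.
     (\<Sum>z\<in>lists_upto L. (sqrt (trace_prob q (defect_left k) z) - sqrt (trace_prob q (defect_right k) z))\<^sup>2) \<le> C * real k powr (-1.35)"
    using hellinger_asymptotic by blast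
  \<comment> \<open>With this \<open>K\<close>, blocks of length \<open>4 * K n + 4\<close> have at
    most 16 n^0.4 possible values.\<close>
  define K :: "nat \<Rightarrow> nat" where "K n = nat \<lfloor>ln (real n) / 10\<rfloor>" for n
  have "filterlim (\<lambda>n :: nat. ln (real n) / 10) at_top sequentially" by real_asymp
  hence K: "filterlim K sequentially sequentially" unfolding K_def
    by (intro filterlim_compose[OF filterlim_nat_sequentially] filterlim_compose[OF filterlim_floor_sequentially])
  have evK: "\<forall>\<^sub>F n in sequentially. \<forall>L.
     (\<Sum>z\<in>lists_upto L. (sqrt (trace_prob q (defect_left (K n)) z) - sqrt (trace_prob q (defect_right (K n)) z))\<^sup>2) \<le> C * real (K n) powr (-1.35)"
    by (rule eventually_compose_filterlim[OF hell K])
  have ev1: "\<forall>\<^sub>F n :: nat in sequentially. 1 \<le> sqrt (ln (ln (real n)))" by real_asymp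
  have ev2: "\<forall>\<^sub>F n :: nat in sequentially. 1 \<le> ln (real n) / 10 - 1" by real_asymp
  have ev3: "\<forall>\<^sub>F n :: nat in sequentially. C * (ln (real n) / 10 - 1) powr (-1.35) \<le> 1"
    using C by real_asymp
  have ev4: "\<forall>\<^sub>F n :: nat in sequentially. 2 * (ln (real n) powr (9/4) + 1) * (C * (ln (real n) / 10 - 1) powr (-1.35)) \<le> 0.2 * ln (real n)"
    using C by real_asymp
  \<comment> \<open>There are of order n / log n blocks, with overlap n^(-0.2) / 2 against at most
    16 n^0.4 strings per block. The exponent 1 - 0.2 - 0.4 exceeds 0.15.\<close>
  have ev5: "\<forall>\<^sub>F n :: nat in sequentially. real n powr 0.15 \<le> (real n / (0.4 * ln (real n) + 4) - 1) * (real n powr (-0.2) / 2) / (16 * real n powr 0.4)"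
    by real_asymp
  have ev6: "\<forall>\<^sub>F n :: nat in sequentially. 0 \<le> real n / (0.4 * ln (real n) + 4) - 1"
    by real_asymp
  show "\<forall>\<^sub>F n::nat in sequentially.
       let T = nat \<lceil>1 * ln (real n) powr (9/4) / sqrt (ln (ln (real n)))\<rceil> in
       \<forall>G \<in> {ts :: bool list list. length ts = T} \<rightarrow> {x. length x = n}.
         reconstruction_prob q n T G \<le> exp (- (real n powr 0.15))"
    using evK ev1 ev2 ev3 ev4 ev5 ev6 eventually_gt_at_top[of 0]
  proof eventually_elim
    case (elim n)
    define l where "l = ln (real n)"
    define T where "T = nat \<lceil>1 * l powr (9/4) / sqrt (ln l)\<rceil>"
    define k where "k = K n"
    define m where "m = 4 * k + 4"
    define h where "h = C * (l / 10 - 1) powr (-1.35)"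
    define \<mu> where "\<mu> = real n powr (-0.2) / 2"
    have n: "1 \<le> real n" using elim by simp
    have l: "1 \<le> l / 10 - 1" "0 \<le> l" using elim by (auto simp: l_def)
    have k: "l / 10 - 1 \<le> real k" "real k \<le> l / 10"
      using l unfolding k_def K_def l_def by linarith+
    have h: "0 \<le> h" "h \<le> 1" using elim C by (auto simp: h_def l_def)
    have "real k powr (-1.35) \<le> (l / 10 - 1) powr (-1.35)"
      using k l by (intro powr_mono2') auto
    hence "C * real k powr (-1.35) \<le> h" using C by (simp add: h_def)
    hence hel: "(\<Sum>z\<in>lists_upto L. (sqrt (trace_prob q (defect_left k) z) - sqrt (trace_prob q (defect_right k) z))\<^sup>2) \<le> h" for L
      using elim(1) unfolding k_def by (meson order_trans)
    \<comment> \<open>The denominator is at least 1 and is dropped.\<close>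
    have "l powr (9/4) / sqrt (ln l) \<le> l powr (9/4) / 1"
      using elim by (intro divide_left_mono) (auto simp: l_def)
    moreover have "0 \<le> l powr (9/4) / sqrt (ln l)"
      using elim by (intro divide_nonneg_nonneg) (auto simp: l_def)
    hence "0 \<le> \<lceil>l powr (9/4) / sqrt (ln l)\<rceil>"
      using le_of_int_ceiling[of "l powr (9/4) / sqrt (ln l)"] by linarith
    hence "real T = of_int \<lceil>l powr (9/4) / sqrt (ln l)\<rceil>" by (simp add: T_def)
    ultimately have T: "real T \<le> l powr (9/4) + 1"
      using ceiling_correct[of "l powr (9/4) / sqrt (ln l)"] by linarith
    have "2 * real T * h \<le> 2 * (l powr (9/4) + 1) * h"
      using T h by (intro mult_right_mono) auto
    also have "\<dots> \<le> 0.2 * l" using elim by (simp add: h_def l_def)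
    finally have "exp (- (0.2 * l)) / 2 \<le> exp (- (2 * real T * h)) / 2" by simp
    moreover have "\<mu> = exp (- (0.2 * l)) / 2" using n by (simp add: \<mu>_def l_def powr_def)
    moreover have "exp (- (2 * real T * h)) / 2 \<le> (\<Sum>ts\<in>lists_len (lists_upto m) T.
        min (pmf (traces_pmf q T (defect_left k)) ts) (pmf (traces_pmf q T (defect_right k)) ts))"
      by (rule overlap_ge[OF _ _ hel h(2)]) (simp_all add: m_def)
    ultimately have \<mu>: "\<mu> \<le> (\<Sum>ts\<in>lists_len (lists_upto m) T. min (pmf (traces_pmf q T (defect_left k)) ts) (pmf (traces_pmf q T (defect_right k)) ts))"
      by linarith
    have \<mu>0: "0 \<le> \<mu>" by (simp add: \<mu>_def)
    have "real n powr (-0.2) \<le> real n powr 0" using n by (intro powr_mono) auto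
    hence \<mu>1: "\<mu> \<le> 1" using n by (simp add: \<mu>_def)
    have m: "real m \<le> 0.4 * l + 4" "0 < m" using k by (auto simp: m_def)
    have div: "real n / (0.4 * l + 4) - 1 \<le> real (n div m)"
    proof -
      have "real n / (0.4 * l + 4) \<le> real n / real m" using m n by (intro divide_left_mono) auto
      also have "\<dots> \<le> real (n div m) + 1"
        using floor_correct[of "real n / real m"] by (simp add: floor_divide_of_nat_eq)
      finally show ?thesis by simp
    qed
    have pow: "2 ^ m \<le> 16 * real n powr 0.4"
    proof -
      have "(2 :: real) ^ m = 16 * 2 ^ (4 * k)" by (simp add: m_def power_add)
      also have "(2 :: real) ^ (4 * k) \<le> exp 1 ^ (4 * k)"
        using exp_ge_add_one_self[of 1] by (intro power_mono) auto
      also have "\<dots> = exp (4 * real k)" by (simp add: exp_of_nat_mult[symmetric])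
      also have "\<dots> \<le> exp (0.4 * l)" using k by simp
      also have "\<dots> = real n powr 0.4" using n by (simp add: l_def powr_def)
      finally show ?thesis by simp
    qed
    have "real n powr 0.15 \<le> (real n / (0.4 * l + 4) - 1) * \<mu> / (16 * real n powr 0.4)"
      using elim by (simp add: l_def \<mu>_def)
    also have "\<dots> \<le> real (n div m) * \<mu> / 2 ^ m"
      using div \<mu>0 pow elim by (intro frac_le mult_right_mono mult_nonneg_nonneg) auto
    finally have "exp (- (real (n div m) * \<mu> / 2 ^ m)) \<le> exp (- (real n powr 0.15))" by simp
    moreover have "reconstruction_prob q n T G \<le> exp (- (real (n div m) * \<mu> / 2 ^ m))" for G
      by (rule reconstruction_prob_le[OF _ _ defect_left_neq_right \<mu> \<mu>1]) (simp_all add: m_def)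
    ultimately have "reconstruction_prob q n T G \<le> exp (- (real n powr 0.15))" for G
      by (meson order_trans)
    thus ?case unfolding Let_def T_def l_def by blast
  qed
qed simp

end
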